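(* Let $p,q,n$ be positive integers with $q\ge n$, and let $\rho$ be a Werner state on $(\mathbb{C}^p\otimes\mathbb{C}^q)^{\otimes n}$. Then \[ \big\|\mathrm{tr}_{\mathbb{C}^q}\rho-\tfrac{\mathcal{I}}{p^n}\big\|\le 2-2\Big(\frac{q-n+1}{q}\Big)^n=\frac{2n(n-1)}{q}+O(n^4/q^2), \] where $\mathcal{I}$ is the identity on $(\mathbb{C}^p)^{\otimes n}$.
   Context: Identify $\mathbb{C}^p\otimes\mathbb{C}^q\cong\mathbb{C}^{pq}$. A Werner state on $(\mathbb{C}^{pq})^{\otimes n}$ is a density operator $\rho$ with $U^{\otimes n}\rho(U^\dagger)^{\otimes n}=\rho$ for all $U$ in the unitary group $\mathcal{U}(pq)$. $\mathrm{tr}_{\mathbb{C}^q}$ is the partial trace over the $\mathbb{C}^q$ factor of each of the $n$ subsystems, yielding an operator on $(\mathbb{C}^p)^{\otimes n}$. $\|\cdot\|$ is the trace norm $\|X\|=\mathrm{tr}|X|$. *)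

theory Defs
  imports Complex_Main "Jordan_Normal_Form.Schur_Decomposition"
begin

text \<open>Matrices are JNF matrices over the complex numbers. The space
  (C^p (x) C^q)^(x n) is identified with C^((p q)^n): a basis index i < (p q)^n
  has base-(p q) digits i div (p q)^k mod (p q) (k < n), and a digit
  d < p q corresponds to the pair (d div q, d mod q) in C^p (x) C^q
  (standard Kronecker ordering).\<close>

definition unitary_mat :: "nat \<Rightarrow> complex mat \<Rightarrow> bool" where
  "unitary_mat d U \<longleftrightarrow> U \<in> carrier_mat d d \<and> mat_adjoint U * U = 1\<^sub>m d"

definition psd_mat :: "nat \<Rightarrow> complex mat \<Rightarrow> bool" where
  "psd_mat d A \<longleftrightarrow> A \<in> carrier_mat d d \<and> mat_adjoint A = A \<and>
     (\<forall>v \<in> carrier_vec d. Im (\<Sum>i<d. cnj (v $ i) * (A *\<^sub>v v) $ i) = 0 \<and>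
                           0 \<le> Re (\<Sum>i<d. cnj (v $ i) * (A *\<^sub>v v) $ i))"

definition mat_trace :: "complex mat \<Rightarrow> complex" where
  "mat_trace A = (\<Sum>i<dim_row A. A $$ (i, i))"

definition density_op :: "nat \<Rightarrow> complex mat \<Rightarrow> bool" where
  "density_op d \<rho> \<longleftrightarrow> psd_mat d \<rho> \<and> mat_trace \<rho> = 1"

definition mat_abs :: "complex mat \<Rightarrow> complex mat" where
  "mat_abs X = (THE P. psd_mat (dim_col X) P \<and> P * P = mat_adjoint X * X)"

definition trace_norm :: "complex mat \<Rightarrow> real" where
  "trace_norm X = Re (mat_trace (mat_abs X))"

definition tensor_pow :: "nat \<Rightarrow> nat \<Rightarrow> complex mat \<Rightarrow> complex mat" where
  "tensor_pow n d U = mat (d ^ n) (d ^ n)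
     (\<lambda>(i, j). \<Prod>k<n. U $$ (i div d ^ k mod d, j div d ^ k mod d))"

definition werner_state :: "nat \<Rightarrow> nat \<Rightarrow> complex mat \<Rightarrow> bool" where
  "werner_state d n \<rho> \<longleftrightarrow> density_op (d ^ n) \<rho> \<and>
     (\<forall>U. unitary_mat d U \<longrightarrow>
        tensor_pow n d U * \<rho> * mat_adjoint (tensor_pow n d U) = \<rho>)"

text \<open>Index of the basis vector |a_1 c_1> (x) ... (x) |a_n c_n> in C^((p q)^n), where
  a < p^n encodes (a_k) in base p and c < q^n encodes (c_k) in base q.\<close>
definition pq_index :: "nat \<Rightarrow> nat \<Rightarrow> nat \<Rightarrow> nat \<Rightarrow> nat \<Rightarrow> nat" where
  "pq_index p q n a c =
     (\<Sum>k<n. ((a div p ^ k mod p) * q + c div q ^ k mod q) * (p * q) ^ k)"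

definition ptrace_q :: "nat \<Rightarrow> nat \<Rightarrow> nat \<Rightarrow> complex mat \<Rightarrow> complex mat" where
  "ptrace_q p q n \<rho> = mat (p ^ n) (p ^ n)
     (\<lambda>(a, b). \<Sum>c<q ^ n. \<rho> $$ (pq_index p q n a c, pq_index p q n b c))"

end

theory Submission
  imports Defs "Jordan_Normal_Form.Spectral_Radius" "HOL-Library.FuncSet"
begin

text \<open>Expand \<open>\<rho>\<close> in the basis of strings \<open>f\<close> of length \<open>n\<close> over \<open>d = p q\<close> symbols. Invariance under
  diagonal unitaries makes \<open>\<rho> f g\<close> vanish unless \<open>f\<close> and \<open>g\<close> are rearrangements of each other, and
  invariance under permutation matrices makes all \<open>\<rho> f f\<close> with injective \<open>f\<close> equal to one number
  \<open>t\<close>. In the partial trace, the terms with an injective \<open>q\<close>-string \<open>c\<close> therefore add up to a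
  multiple \<open>\<alpha> / p\<^sup>n\<close> of the identity, where \<open>\<alpha> = p\<^sup>n q (q - 1) \<dots> (q - n + 1) t\<close>, and the other terms to
  a positive operator of trace \<open>1 - \<alpha>\<close>; the trace distance is thus at most \<open>2 (1 - \<alpha>)\<close>.

  For the lower bound on \<open>t\<close>, let \<open>h\<close> contain \<open>a\<close> but not \<open>b\<close>. Differentiating the invariance under
  rotations in the plane of \<open>a\<close> and \<open>b\<close> and applying Cauchy-Schwarz bounds \<open>\<rho> h h\<close> by the sum of
  \<open>\<rho> h' h'\<close> over all \<open>h'\<close> obtained by turning one \<open>a\<close> of \<open>h\<close> into \<open>b\<close>. By iteration \<open>\<rho> h h\<close> is at
  most \<open>t\<close> times the product of the factorials of the multiplicities of \<open>h\<close>. These products sum to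
  \<open>d (d + 1) \<dots> (d + n - 1)\<close>, so \<open>t\<close> is at least the reciprocal of that number.\<close>

section \<open>Spectral theorem for Hermitian matrices\<close>

lemma mat_adjoint_carrier [simp]:
  "A \<in> carrier_mat m k \<Longrightarrow> mat_adjoint A \<in> carrier_mat k m"
  unfolding mat_adjoint_def by auto

lemma mat_adjoint_dim [simp]:
  "dim_row (mat_adjoint A) = dim_col A" "dim_col (mat_adjoint A) = dim_row A"
  unfolding mat_adjoint_def by auto

lemma square_mult_carrier_mat:
  "A \<in> carrier_mat d d \<Longrightarrow> B \<in> carrier_mat d d \<Longrightarrow> A * B \<in> carrier_mat d d"
  by simp

lemmas square_assoc_mult = assoc_mult_mat[of _ d d _ d _ d for d]

lemma mat_adjoint_index [simp]:
  fixes A :: "complex mat"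
  assumes "i < dim_col A" "j < dim_row A"
  shows "mat_adjoint A $$ (i, j) = cnj (A $$ (j, i))"
  using assms unfolding mat_adjoint_def by (simp add: mat_of_rows_index)

lemma mat_adjoint_adjoint:
  fixes A :: "complex mat"
  assumes "A \<in> carrier_mat m k"
  shows "mat_adjoint (mat_adjoint A) = A"
  using assms mat_adjoint_carrier[OF assms] mat_adjoint_carrier[OF mat_adjoint_carrier[OF assms]]
  by (intro eq_matI) (auto simp del: mat_adjoint_carrier)

lemma mat_adjoint_mult:
  fixes A B :: "complex mat"
  assumes A: "A \<in> carrier_mat m k" and B: "B \<in> carrier_mat k l"
  shows "mat_adjoint (A * B) = mat_adjoint B * mat_adjoint A"
proof (rule eq_matI)
  note c = mat_adjoint_carrier[OF A] mat_adjoint_carrier[OF B] mat_adjoint_carrier[OF mult_carrier_mat[OF A B]]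
  show "dim_row (mat_adjoint (A * B)) = dim_row (mat_adjoint B * mat_adjoint A)"
    "dim_col (mat_adjoint (A * B)) = dim_col (mat_adjoint B * mat_adjoint A)"
    using A B c by auto
  fix i j assume "i < dim_row (mat_adjoint B * mat_adjoint A)" "j < dim_col (mat_adjoint B * mat_adjoint A)"
  hence i: "i < l" and j: "j < m" using c by auto
  have d: "dim_row A = m" "dim_col A = k" "dim_row B = k" "dim_col B = l"
    "dim_row (mat_adjoint A) = k" "dim_col (mat_adjoint A) = m"
    "dim_row (mat_adjoint B) = l" "dim_col (mat_adjoint B) = k" using A B c by auto
  show "mat_adjoint (A * B) $$ (i, j) = (mat_adjoint B * mat_adjoint A) $$ (i, j)"
    using i j d by (simp add: scalar_prod_def mult.commute)
qed

lemma index_mult_mat_sum: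
  fixes A B :: "'a :: semiring_0 mat"
  assumes "A \<in> carrier_mat m k" "B \<in> carrier_mat k l" "i < m" "j < l"
  shows "(A * B) $$ (i, j) = (\<Sum>s<k. A $$ (i, s) * B $$ (s, j))"
  using assms by (simp add: scalar_prod_def atLeast0LessThan)

lemma unitary_mat_inverse:
  assumes "unitary_mat d U"
  shows "U \<in> carrier_mat d d" "mat_adjoint U \<in> carrier_mat d d"
    "mat_adjoint U * U = 1\<^sub>m d" "U * mat_adjoint U = 1\<^sub>m d"
proof -
  show U: "U \<in> carrier_mat d d" and I: "mat_adjoint U * U = 1\<^sub>m d"
    using assms unfolding unitary_mat_def by auto
  show Ua: "mat_adjoint U \<in> carrier_mat d d" using U by simp
  show "U * mat_adjoint U = 1\<^sub>m d" using mat_mult_left_right_inverse[OF Ua U I] .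
qed

lemma unitary_mat_mult:
  assumes "unitary_mat d U" "unitary_mat d V"
  shows "unitary_mat d (U * V)"
proof -
  note U = unitary_mat_inverse[OF assms(1)] and V = unitary_mat_inverse[OF assms(2)]
  have "mat_adjoint (U * V) * (U * V) = mat_adjoint V * (mat_adjoint U * U) * V"
    unfolding mat_adjoint_mult[OF U(1) V(1)] using U(1,2) V(1,2)
    by (simp add: square_assoc_mult[of _ d] square_mult_carrier_mat)
  also have "\<dots> = 1\<^sub>m d" using U(3) V by simp
  finally show ?thesis unfolding unitary_mat_def using U V by auto
qed

text \<open>Completing \<open>v\<close> to a basis with \<open>v\<close> first and orthogonalising
  leaves \<open>v\<close> unchanged as first vector. Normalising then makes column 0 a multiple
  \<open>c\<close> of \<open>v\<close>.\<close>

lemma unitary_mat_extend_vec: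
  fixes v :: "complex vec"
  assumes v: "v \<in> carrier_vec d" and v0: "v \<noteq> 0\<^sub>v d"
  obtains W c where "unitary_mat d W" "c \<noteq> 0" "col W 0 = c \<cdot>\<^sub>v v"
proof -
  interpret cof_vec_space d "TYPE(complex)" .
  have d0: "d \<noteq> 0" using v v0 by auto
  note bc = basis_completion[OF v v0]
  define ws where "ws = gram_schmidt d (basis_completion v)"
  note gs = gram_schmidt_result[OF bc(2,4,5) ws_def]
  have len: "length ws = d" using gs(4) bc(6) by simp
  have bcne: "basis_completion v = v # tl (basis_completion v)"
    using bc(6,7) d0 by (metis hd_Cons_tl list.size(3))
  have hd: "hd ws = v" unfolding ws_def by (subst bcne, subst gram_schmidt_hd) (use v in auto)
  have ws0: "ws ! 0 = v" using hd len d0 by (metis hd_conv_nth list.size(3))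
  have car: "ws ! i \<in> carrier_vec d" if "i < d" for i using gs(3) len that by auto
  have orth: "(ws ! i \<bullet>c ws ! j = 0) \<longleftrightarrow> i \<noteq> j" if "i < d" "j < d" for i j
    using corthogonalD[OF gs(2)] that len by auto
  define N where "N i = (\<Sum>k<d. (cmod (ws ! i $ k))\<^sup>2)" for i
  have NN: "ws ! i \<bullet>c ws ! i = of_real (N i)" if "i < d" for i
    using car[OF that] unfolding N_def scalar_prod_def
    by (auto simp: atLeast0LessThan complex_norm_square[symmetric] power2_eq_square intro!: sum.cong)
  have Npos: "N i > 0" if "i < d" for i
  proof -
    have "N i \<ge> 0" unfolding N_def by (intro sum_nonneg) auto
    moreover have "N i \<noteq> 0" using NN[OF that] orth[OF that that] by auto
    ultimately show ?thesis by simp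
  qed
  \<comment> \<open>Gram-Schmidt yields orthogonal vectors of arbitrary length. \<open>N j\<close>
    is the squared norm of the \<open>j\<close>-th one, so dividing by its root makes the columns
    orthonormal.\<close>
  define W where "W = mat d d (\<lambda>(i, j). ws ! j $ i / of_real (sqrt (N j)))"
  have Wc: "W \<in> carrier_mat d d" unfolding W_def by simp
  have "mat_adjoint W * W = 1\<^sub>m d"
  proof (rule eq_matI)
    fix i j assume "i < dim_row (1\<^sub>m d :: complex mat)" "j < dim_col (1\<^sub>m d :: complex mat)"
    hence i: "i < d" and j: "j < d" by auto
    have "(mat_adjoint W * W) $$ (i, j) = (\<Sum>s<d. mat_adjoint W $$ (i, s) * W $$ (s, j))"
      by (rule index_mult_mat_sum[OF mat_adjoint_carrier[OF Wc] Wc i j])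
    also have "\<dots> = (\<Sum>s<d. ws ! j $ s * cnj (ws ! i $ s) / (of_real (sqrt (N i)) * of_real (sqrt (N j))))"
      using i j by (intro sum.cong) (auto simp: W_def)
    also have "\<dots> = (ws ! j \<bullet>c ws ! i) / (of_real (sqrt (N i)) * of_real (sqrt (N j)))"
      using car[OF i] car[OF j] by (simp add: scalar_prod_def atLeast0LessThan sum_divide_distrib)
    also have "\<dots> = (if i = j then 1 else 0)"
    proof (cases "i = j")
      case True
      have "complex_of_real (sqrt (N i)) * of_real (sqrt (N i)) = of_real (N i)"
        using Npos[OF i] by (simp flip: of_real_mult)
      thus ?thesis using True NN[OF i] Npos[OF i] by simp
    next
      case False thus ?thesis using orth[OF j i] by simp
    qed
    finally show "(mat_adjoint W * W) $$ (i, j) = 1\<^sub>m d $$ (i, j)" using i j by simp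
  qed (use Wc mat_adjoint_carrier[OF Wc] in auto)
  hence "unitary_mat d W" using Wc unfolding unitary_mat_def by simp
  moreover have "col W 0 = (1 / of_real (sqrt (N 0))) \<cdot>\<^sub>v v"
    using d0 v by (intro eq_vecI) (auto simp: W_def ws0)
  moreover have "1 / complex_of_real (sqrt (N 0)) \<noteq> 0" using Npos[of 0] d0 by simp
  ultimately show ?thesis using that by blast
qed

text \<open>The type of \<open>l\<close> already records that the eigenvalues of a Hermitian matrix
  are real.\<close>

definition real_diag :: "nat \<Rightarrow> (nat \<Rightarrow> real) \<Rightarrow> complex mat" where
  "real_diag d l = mat d d (\<lambda>(i, j). if i = j then of_real (l i) else 0)"

lemma real_diag_carrier [simp]: "real_diag d l \<in> carrier_mat d d"
  unfolding real_diag_def by simp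

text \<open>Induction on the dimension. A unitary \<open>W\<close> whose first column is an
  eigenvector splits off a one-dimensional block: the first column of
  \<open>mat_adjoint W * A * W\<close> vanishes below the diagonal, hence so does the first row
  beside it, and the remaining block is again Hermitian.\<close>

theorem hermitian_spectral_decomposition:
  fixes A :: "complex mat"
  assumes "A \<in> carrier_mat d d" "mat_adjoint A = A"
  obtains U l where "unitary_mat d U" "A = U * real_diag d l * mat_adjoint U"
proof -
  \<comment> \<open>The induction carries the equivalent form with the unitaries on the side of
    \<open>A\<close>, since there the two successive conjugations simply compose to
    \<open>W * V\<close>.\<close>
  have "\<exists>U l. unitary_mat d U \<and> mat_adjoint U * A * U = real_diag d l"
    using assms
  proof (induction d arbitrary: A)
    case 0
    show ?case
      by (rule exI[of _ "1\<^sub>m 0"], rule exI[of _ "\<lambda>_. 0"])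
        (use 0 in \<open>auto simp: unitary_mat_def real_diag_def intro!: eq_matI\<close>)
  next
    case (Suc d)
    note A = Suc.prems(1)
    obtain e where "e \<in> spectrum A" using spectrum_non_empty[OF A] by auto
    then obtain v where "eigenvector A v e" unfolding spectrum_def eigenvalue_def by auto
    hence v: "v \<in> carrier_vec (Suc d)" "v \<noteq> 0\<^sub>v (Suc d)" and ev: "A *\<^sub>v v = e \<cdot>\<^sub>v v"
      using A unfolding eigenvector_def by auto
    obtain W c where W: "unitary_mat (Suc d) W" and c: "c \<noteq> 0" "col W 0 = c \<cdot>\<^sub>v v"
      using unitary_mat_extend_vec[OF v] .
    note Wi = unitary_mat_inverse[OF W]
    define B where "B = mat_adjoint W * A * W"
    have B: "B \<in> carrier_mat (Suc d) (Suc d)" unfolding B_def using Wi A by (simp add: square_mult_carrier_mat)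
    have Bh: "mat_adjoint B = B"
    proof -
      have "mat_adjoint B = mat_adjoint W * (mat_adjoint A * mat_adjoint (mat_adjoint W))"
        unfolding B_def by (simp only: mat_adjoint_mult[OF mult_carrier_mat[OF Wi(2) A] Wi(1)]
          mat_adjoint_mult[OF Wi(2) A])
      thus ?thesis unfolding B_def mat_adjoint_adjoint[OF Wi(1)] Suc.prems(2)
        using Wi A by (simp add: assoc_mult_mat[OF Wi(2) A Wi(1)])
    qed
    \<comment> \<open>\<open>W\<close> sends the first unit vector to an eigenvector, so this unit
      vector is an eigenvector of \<open>B\<close>.\<close>
    have "col B 0 = mat_adjoint W *\<^sub>v col (A * W) 0"
      unfolding B_def assoc_mult_mat[OF Wi(2) A Wi(1)]
      by (rule col_mult2[OF Wi(2) mult_carrier_mat[OF A Wi(1)]]) simp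
    also have "col (A * W) 0 = A *\<^sub>v col W 0"
      by (rule col_mult2[OF A Wi(1)]) simp
    also have "A *\<^sub>v col W 0 = e \<cdot>\<^sub>v col W 0"
      unfolding c(2) using A v ev
      by (simp add: mult_mat_vec[OF A v(1)] smult_smult_assoc mult.commute)
    also have "mat_adjoint W *\<^sub>v (e \<cdot>\<^sub>v col W 0) = e \<cdot>\<^sub>v (mat_adjoint W *\<^sub>v col W 0)"
      using Wi(1) by (intro mult_mat_vec[OF Wi(2)]) (metis carrier_matD(1) col_dim)
    also have "mat_adjoint W *\<^sub>v col W 0 = col (mat_adjoint W * W) 0"
      by (rule col_mult2[OF Wi(2,1), symmetric]) simp
    finally have "col B 0 = e \<cdot>\<^sub>v col (1\<^sub>m (Suc d)) 0" using Wi by simp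
    hence Bcol: "B $$ (i, 0) = (if i = 0 then e else 0)" if "i < Suc d" for i
      using B that by (metis (no_types, lifting) carrier_matD col_one index_col index_smult_vec(1)
          index_unit_vec(1) index_unit_vec(3) mult.right_neutral mult_zero_right zero_less_Suc)
    have Bij: "B $$ (i, j) = cnj (B $$ (j, i))" if "i < Suc d" "j < Suc d" for i j
      using mat_adjoint_index[of i B j] B Bh that by auto
    have Brow: "B $$ (0, j) = (if j = 0 then e else 0)" if "j < Suc d" for j
      using Bij[of 0 j] Bcol[of j] Bcol[of 0] that by (cases "j = 0") auto
    have ereal: "cnj e = e" using Bij[of 0 0] Bcol[of 0] by simp
    define A3 where "A3 = mat d d (\<lambda>(i, j). B $$ (Suc i, Suc j))"
    have A3: "A3 \<in> carrier_mat d d" unfolding A3_def by simp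
    have "mat_adjoint A3 = A3"
    proof (rule eq_matI)
      fix i j assume "i < dim_row A3" "j < dim_col A3"
      hence "i < d" "j < d" using A3 by auto
      thus "mat_adjoint A3 $$ (i, j) = A3 $$ (i, j)"
        using A3 Bij[of "Suc i" "Suc j"] by (simp add: A3_def)
    qed (use A3 mat_adjoint_carrier[OF A3] in auto)
    from Suc.IH[OF A3 this] obtain U3 l3 where U3: "unitary_mat d U3"
      and l3: "mat_adjoint U3 * A3 * U3 = real_diag d l3" by blast
    note U3i = unitary_mat_inverse[OF U3]
    \<comment> \<open>\<open>V\<close> is the block sum of the number 1 and \<open>U3\<close>;
      conjugation by it diagonalises the lower block and keeps the entry \<open>e\<close>.\<close>
    define V where "V = mat (Suc d) (Suc d) (\<lambda>(i, j). if i = 0 \<or> j = 0 then (if i = j then 1 else 0)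
       else U3 $$ (i - 1, j - 1))"
    have V: "V \<in> carrier_mat (Suc d) (Suc d)" unfolding V_def by simp
    note Va = mat_adjoint_carrier[OF V]
    define l where "l i = (if i = 0 then Re e else l3 (i - 1))" for i
    have Vent: "V $$ (0, 0) = 1" "\<And>i. i < d \<Longrightarrow> V $$ (0, Suc i) = 0" "\<And>i. i < d \<Longrightarrow> V $$ (Suc i, 0) = 0"
      "\<And>i j. i < d \<Longrightarrow> j < d \<Longrightarrow> V $$ (Suc i, Suc j) = U3 $$ (i, j)" unfolding V_def by auto
    have dV: "dim_row V = Suc d" "dim_col V = Suc d" using V by auto
    have dU: "dim_row U3 = d" "dim_col U3 = d" using U3i by auto
    have U3prod: "(\<Sum>s<d. cnj (U3 $$ (s, i)) * U3 $$ (s, j)) = (if i = j then 1 else 0)"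
      if "i < d" "j < d" for i j
    proof -
      have "(mat_adjoint U3 * U3) $$ (i, j) = (\<Sum>s<d. cnj (U3 $$ (s, i)) * U3 $$ (s, j))"
        using index_mult_mat_sum[OF U3i(2,1) that] that dU by simp
      thus ?thesis using U3i(3) that by simp
    qed
    have "mat_adjoint V * V = 1\<^sub>m (Suc d)"
    proof (rule eq_matI)
      fix i j assume "i < dim_row (1\<^sub>m (Suc d) :: complex mat)" "j < dim_col (1\<^sub>m (Suc d) :: complex mat)"
      hence i: "i < Suc d" and j: "j < Suc d" by auto
      have "(mat_adjoint V * V) $$ (i, j) = (\<Sum>s<Suc d. cnj (V $$ (s, i)) * V $$ (s, j))"
        using index_mult_mat_sum[OF Va V i j] i j dV by simp
      also have "\<dots> = (if i = j then 1 else 0)"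
        unfolding sum.lessThan_Suc_shift using i j U3prod
        by (cases i; cases j) (auto simp: Vent)
      finally show "(mat_adjoint V * V) $$ (i, j) = 1\<^sub>m (Suc d) $$ (i, j)" using i j by simp
    qed (use V Va in auto)
    hence Vu: "unitary_mat (Suc d) V" using V unfolding unitary_mat_def by simp
    have A3U3ij: "(A3 * U3) $$ (i, j) = (\<Sum>s<d. B $$ (Suc i, Suc s) * U3 $$ (s, j))"
      if "i < d" "j < d" for i j
      unfolding index_mult_mat_sum[OF A3 U3i(1) that] using that by (simp add: A3_def)
    have BV: "(B * V) $$ (i, j) = (if i = 0 \<or> j = 0 then (if i = j then e else 0) else (A3 * U3) $$ (i - 1, j - 1))"
      if "i < Suc d" "j < Suc d" for i j
    proof -
      have "(B * V) $$ (i, j) = (\<Sum>s<Suc d. B $$ (i, s) * V $$ (s, j))"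
        using index_mult_mat_sum[OF B V that] .
      also have "\<dots> = (if i = 0 \<or> j = 0 then (if i = j then e else 0) else (A3 * U3) $$ (i - 1, j - 1))"
        unfolding sum.lessThan_Suc_shift using that
        by (cases i; cases j) (auto simp: Vent Bcol Brow A3U3ij)
      finally show ?thesis .
    qed
    have A3U3: "A3 * U3 \<in> carrier_mat d d" using A3 U3i by (simp add: square_mult_carrier_mat)
    have "mat_adjoint V * (B * V) = real_diag (Suc d) l"
    proof (rule eq_matI)
      fix i j assume "i < dim_row (real_diag (Suc d) l)" "j < dim_col (real_diag (Suc d) l)"
      hence i: "i < Suc d" and j: "j < Suc d" using real_diag_carrier[of "Suc d" l] by auto
      have U3A: "(\<Sum>s<d. cnj (U3 $$ (s, i)) * (A3 * U3) $$ (s, j)) = real_diag d l3 $$ (i, j)"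
        if "i < d" "j < d" for i j
        using index_mult_mat_sum[OF U3i(2) A3U3 that] that dU l3 assoc_mult_mat[OF U3i(2) A3 U3i(1)]
        by (simp del: index_mult_mat(1))
      have "(mat_adjoint V * (B * V)) $$ (i, j) = (\<Sum>s<Suc d. cnj (V $$ (s, i)) * (B * V) $$ (s, j))"
        using index_mult_mat_sum[OF Va mult_carrier_mat[OF B V] i j] i j dV by simp
      also have "\<dots> = real_diag (Suc d) l $$ (i, j)"
        unfolding sum.lessThan_Suc_shift using i j U3A ereal
        by (cases i; cases j) (auto simp: Vent BV real_diag_def l_def complex_eq_iff)
      finally show "(mat_adjoint V * (B * V)) $$ (i, j) = real_diag (Suc d) l $$ (i, j)" .
    qed (use V B in \<open>auto simp: real_diag_def\<close>)
    moreover have "mat_adjoint (W * V) * A * (W * V) = mat_adjoint V * (B * V)"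
      unfolding B_def mat_adjoint_mult[OF Wi(1) V] using A Wi V Va
      by (simp add: square_assoc_mult[of _ "Suc d"] square_mult_carrier_mat)
    ultimately show ?case using unitary_mat_mult[OF W Vu] by metis
  qed
  then obtain U l where U: "unitary_mat d U" and l: "mat_adjoint U * A * U = real_diag d l" by blast
  note Ui = unitary_mat_inverse[OF U]
  have "U * real_diag d l * mat_adjoint U = (U * mat_adjoint U) * A * (U * mat_adjoint U)"
    unfolding l[symmetric] using Ui(1,2) assms(1) by (simp add: square_assoc_mult[of _ d] square_mult_carrier_mat)
  also have "\<dots> = A" using Ui assms(1) by simp
  finally show ?thesis using that U by metis
qed

section \<open>The trace norm\<close>

lemma quadratic_form_sum:
  fixes A :: "complex mat"
  assumes "A \<in> carrier_mat d d" "v \<in> carrier_vec d"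
  shows "(\<Sum>i<d. cnj (v $ i) * (A *\<^sub>v v) $ i) = (\<Sum>i<d. \<Sum>j<d. cnj (v $ i) * A $$ (i, j) * v $ j)"
  using assms by (auto simp: scalar_prod_def atLeast0LessThan sum_distrib_left mult.assoc intro!: sum.cong)

lemma unitary_conj_diag_index:
  assumes U: "U \<in> carrier_mat d d" and "i < d" "j < d"
  shows "(U * real_diag d l * mat_adjoint U) $$ (i, j) =
    (\<Sum>s<d. of_real (l s) * U $$ (i, s) * cnj (U $$ (j, s)))"
proof -
  have UD: "(U * real_diag d l) $$ (i, s) = of_real (l s) * U $$ (i, s)" if "s < d" for s
  proof -
    have "(U * real_diag d l) $$ (i, s) = (\<Sum>k<d. U $$ (i, k) * real_diag d l $$ (k, s))"
      by (rule index_mult_mat_sum[OF U real_diag_carrier assms(2) that])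
    also have "\<dots> = (\<Sum>k<d. if k = s then of_real (l s) * U $$ (i, s) else 0)"
      using that by (intro sum.cong) (auto simp: real_diag_def)
    finally show ?thesis using that by simp
  qed
  have "(U * real_diag d l * mat_adjoint U) $$ (i, j) =
    (\<Sum>s<d. (U * real_diag d l) $$ (i, s) * mat_adjoint U $$ (s, j))"
    by (rule index_mult_mat_sum[OF mult_carrier_mat[OF U real_diag_carrier] mat_adjoint_carrier[OF U] assms(2,3)])
  also have "\<dots> = (\<Sum>s<d. of_real (l s) * U $$ (i, s) * cnj (U $$ (j, s)))"
    using assms by (intro sum.cong) (auto simp: UD)
  finally show ?thesis .
qed

lemma unitary_conj_diag_hermitian:
  assumes U: "U \<in> carrier_mat d d"
  shows "mat_adjoint (U * real_diag d l * mat_adjoint U) = U * real_diag d l * mat_adjoint U"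
    (is "mat_adjoint ?A = ?A")
proof (rule eq_matI)
  have A: "?A \<in> carrier_mat d d" using U by (simp add: square_mult_carrier_mat)
  fix i j assume "i < dim_row ?A" "j < dim_col ?A"
  hence ij: "i < d" "j < d" using U by auto
  have "mat_adjoint ?A $$ (i, j) = cnj (?A $$ (j, i))"
    by (rule mat_adjoint_index) (use ij U in auto)
  thus "mat_adjoint ?A $$ (i, j) = ?A $$ (i, j)"
    using ij by (simp add: unitary_conj_diag_index[OF U] mult_ac del: index_mult_mat(1))
qed (use U in auto)

text \<open>The quadratic form at \<open>v\<close> becomes the sum of the \<open>l s\<close>
  weighted with squared moduli.\<close>

lemma unitary_conj_diag_psd:
  assumes U: "U \<in> carrier_mat d d" and l: "\<And>s. s < d \<Longrightarrow> l s \<ge> 0"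
  shows "psd_mat d (U * real_diag d l * mat_adjoint U)" (is "psd_mat d ?A")
proof -
  have A: "?A \<in> carrier_mat d d" using U by (simp add: square_mult_carrier_mat)
  note herm = unitary_conj_diag_hermitian[OF U, of l]
  have "\<exists>x\<ge>0. (\<Sum>i<d. cnj (v $ i) * (?A *\<^sub>v v) $ i) = complex_of_real x"
    if v: "v \<in> carrier_vec d" for v
  proof -
    \<comment> \<open>\<open>w s\<close> is the inner product of \<open>v\<close> with column
      \<open>s\<close> of \<open>U\<close>.\<close>
    define w where "w s = (\<Sum>i<d. cnj (v $ i) * U $$ (i, s))" for s
    have "(\<Sum>i<d. cnj (v $ i) * (?A *\<^sub>v v) $ i) =
      (\<Sum>i<d. \<Sum>j<d. cnj (v $ i) * (\<Sum>s<d. of_real (l s) * U $$ (i, s) * cnj (U $$ (j, s))) * v $ j)"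
      unfolding quadratic_form_sum[OF A v] by (simp add: unitary_conj_diag_index[OF U])
    also have "\<dots> = (\<Sum>i<d. \<Sum>j<d. \<Sum>s<d. of_real (l s) * (cnj (v $ i) * U $$ (i, s)) * cnj (cnj (v $ j) * U $$ (j, s)))"
      by (simp add: sum_distrib_left sum_distrib_right mult_ac)
    also have "\<dots> = (\<Sum>s<d. \<Sum>i<d. \<Sum>j<d. of_real (l s) * (cnj (v $ i) * U $$ (i, s)) * cnj (cnj (v $ j) * U $$ (j, s)))"
      by (rule trans[OF sum.cong[OF refl sum.swap] sum.swap])
    also have "\<dots> = (\<Sum>s<d. of_real (l s) * (w s * cnj (w s)))"
      unfolding w_def cnj_sum sum_product by (simp add: sum_distrib_left mult.assoc)
    also have "\<dots> = of_real (\<Sum>s<d. l s * (cmod (w s))\<^sup>2)"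
      by (simp flip: complex_norm_square)
    finally show ?thesis using l by (intro exI[of _ "\<Sum>s<d. l s * (cmod (w s))\<^sup>2"]) (auto intro!: sum_nonneg)
  qed
  hence "Im (\<Sum>i<d. cnj (v $ i) * (?A *\<^sub>v v) $ i) = 0 \<and> 0 \<le> Re (\<Sum>i<d. cnj (v $ i) * (?A *\<^sub>v v) $ i)"
    if "v \<in> carrier_vec d" for v
    using that by (metis Im_complex_of_real Re_complex_of_real)
  thus ?thesis unfolding psd_mat_def using A herm by blast
qed

text \<open>Each \<open>l s\<close> enters with the squared norm of column \<open>s\<close> of
  \<open>U\<close> as its weight, which is 1.\<close>

lemma unitary_conj_diag_trace:
  assumes "unitary_mat d U"
  shows "mat_trace (U * real_diag d l * mat_adjoint U) = of_real (\<Sum>s<d. l s)"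
proof -
  note Ui = unitary_mat_inverse[OF assms]
  have "mat_trace (U * real_diag d l * mat_adjoint U) = (\<Sum>i<d. \<Sum>s<d. of_real (l s) * U $$ (i, s) * cnj (U $$ (i, s)))"
    using Ui(1) unfolding mat_trace_def by (simp add: unitary_conj_diag_index[OF Ui(1)] del: index_mult_mat(1))
  also have "\<dots> = (\<Sum>s<d. of_real (l s) * (\<Sum>i<d. cnj (U $$ (i, s)) * U $$ (i, s)))"
    by (subst sum.swap) (simp add: sum_distrib_left mult_ac)
  also have "\<dots> = (\<Sum>s<d. of_real (l s))"
  proof (rule sum.cong)
    fix s assume "s \<in> {..<d}"
    hence s: "s < d" by simp
    have "(\<Sum>i<d. cnj (U $$ (i, s)) * U $$ (i, s)) = (mat_adjoint U * U) $$ (s, s)"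
      using index_mult_mat_sum[OF Ui(2,1) s s] Ui(1) s by simp
    thus "of_real (l s) * (\<Sum>i<d. cnj (U $$ (i, s)) * U $$ (i, s)) = complex_of_real (l s)"
      using Ui(3) s by simp
  qed simp
  finally show ?thesis by simp
qed

lemma unitary_conj_diag_square:
  assumes "unitary_mat d U"
  shows "(U * real_diag d l * mat_adjoint U) * (U * real_diag d l * mat_adjoint U) =
    U * real_diag d (\<lambda>s. (l s)\<^sup>2) * mat_adjoint U"
proof -
  note Ui = unitary_mat_inverse[OF assms]
  have DD: "real_diag d l * real_diag d l = real_diag d (\<lambda>s. (l s)\<^sup>2)"
  proof (rule eq_matI)
    fix i j assume "i < dim_row (real_diag d (\<lambda>s. (l s)\<^sup>2))" "j < dim_col (real_diag d (\<lambda>s. (l s)\<^sup>2))"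
    hence ij: "i < d" "j < d" by (auto simp: real_diag_def)
    have "(real_diag d l * real_diag d l) $$ (i, j) = (\<Sum>s<d. real_diag d l $$ (i, s) * real_diag d l $$ (s, j))"
      by (rule index_mult_mat_sum[OF real_diag_carrier real_diag_carrier ij])
    also have "\<dots> = (\<Sum>s<d. if s = i then (if i = j then of_real ((l i)\<^sup>2) else 0) else 0)"
      using ij by (intro sum.cong) (auto simp: real_diag_def power2_eq_square)
    finally show "(real_diag d l * real_diag d l) $$ (i, j) = real_diag d (\<lambda>s. (l s)\<^sup>2) $$ (i, j)"
      using ij by (simp add: real_diag_def)
  qed (auto simp: real_diag_def)
  have "(U * real_diag d l * mat_adjoint U) * (U * real_diag d l * mat_adjoint U) =
    U * (real_diag d l * ((mat_adjoint U * U) * (real_diag d l * mat_adjoint U)))"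
    using Ui(1) by (simp add: square_assoc_mult[of _ d] square_mult_carrier_mat)
  also have "\<dots> = U * (real_diag d l * real_diag d l) * mat_adjoint U"
    using Ui(1) by (simp add: Ui(3) square_assoc_mult[of _ d] square_mult_carrier_mat left_mult_one_mat[of _ d d])
  finally show ?thesis unfolding DD .
qed

text \<open>The diagonal entry \<open>s\<close> after conjugation is the quadratic form of
  \<open>A\<close> at column \<open>s\<close> of \<open>U\<close>.\<close>

lemma psd_mat_unitary_conj_diag:
  assumes A: "psd_mat d A" and U: "U \<in> carrier_mat d d" and s: "s < d"
  shows "Im ((mat_adjoint U * A * U) $$ (s, s)) = 0" "0 \<le> Re ((mat_adjoint U * A * U) $$ (s, s))"
proof -
  have Ac: "A \<in> carrier_mat d d" using A unfolding psd_mat_def by simp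
  have v: "col U s \<in> carrier_vec d" using U by auto
  have AU: "A * U \<in> carrier_mat d d" using Ac U by simp
  have "(mat_adjoint U * A * U) $$ (s, s) = (mat_adjoint U * (A * U)) $$ (s, s)"
    using Ac U by (simp add: square_assoc_mult[of _ d])
  also have "\<dots> = (\<Sum>i<d. mat_adjoint U $$ (s, i) * (A * U) $$ (i, s))"
    by (rule index_mult_mat_sum[OF mat_adjoint_carrier[OF U] AU s s])
  also have "\<dots> = (\<Sum>i<d. cnj (col U s $ i) * (A *\<^sub>v col U s) $ i)"
    using Ac U s by (intro sum.cong) auto
  finally show "Im ((mat_adjoint U * A * U) $$ (s, s)) = 0" "0 \<le> Re ((mat_adjoint U * A * U) $$ (s, s))"
    using A v unfolding psd_mat_def by auto
qed

lemma mat_adjoint_minus: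
  fixes A B :: "complex mat"
  assumes "A \<in> carrier_mat m k" "B \<in> carrier_mat m k"
  shows "mat_adjoint (A - B) = mat_adjoint A - mat_adjoint B"
  using assms by (intro eq_matI) auto

lemma unitary_conj_minus:
  assumes "U \<in> carrier_mat d d" "A \<in> carrier_mat d d" "B \<in> carrier_mat d d"
  shows "mat_adjoint U * (A - B) * U = mat_adjoint U * A * U - mat_adjoint U * B * (U :: complex mat)"
proof -
  have c: "mat_adjoint U * A \<in> carrier_mat d d" "mat_adjoint U * B \<in> carrier_mat d d"
    using assms by (simp_all add: square_mult_carrier_mat)
  show ?thesis
    by (simp only: mult_minus_distrib_mat[OF mat_adjoint_carrier[OF assms(1)] assms(2,3)]
      minus_mult_distrib_mat[OF c assms(1)])
qed

lemma unitary_conj_diag_cancel: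
  assumes "unitary_mat d U"
  shows "mat_adjoint U * (U * real_diag d l * mat_adjoint U) * U = real_diag d l"
proof -
  note Ui = unitary_mat_inverse[OF assms]
  have "mat_adjoint U * (U * real_diag d l * mat_adjoint U) * U = (mat_adjoint U * U) * (real_diag d l * (mat_adjoint U * U))"
    using Ui(1) by (simp add: square_assoc_mult[of _ d] square_mult_carrier_mat)
  thus ?thesis unfolding Ui(3) by (simp add: left_mult_one_mat[of _ d d] right_mult_one_mat[of _ d d])
qed

text \<open>In an eigenbasis of \<open>P - Q\<close> with eigenvalues \<open>l\<close>, the diagonal of
  \<open>P * P - Q * Q = P * (P - Q) + (P - Q) * Q\<close> reads \<open>l s * (P s s + Q s s) = 0\<close>.\<close>
lemma psd_mat_square_root_unique:
  assumes P: "psd_mat d P" and Q: "psd_mat d Q" and eq: "P * P = Q * Q"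
  shows "P = Q"
proof -
  have Pc: "P \<in> carrier_mat d d" and Qc: "Q \<in> carrier_mat d d"
    and h: "mat_adjoint P = P" "mat_adjoint Q = Q" using P Q unfolding psd_mat_def by auto
  have Hc: "P - Q \<in> carrier_mat d d" using Qc by (rule minus_carrier_mat)
  obtain U l where U: "unitary_mat d U" and H: "P - Q = U * real_diag d l * mat_adjoint U"
    using hermitian_spectral_decomposition[OF Hc] h mat_adjoint_minus[OF Pc Qc] by metis
  note Ui = unitary_mat_inverse[OF U]
  define P' where "P' = mat_adjoint U * P * U"
  define Q' where "Q' = mat_adjoint U * Q * U"
  have P': "P' \<in> carrier_mat d d" and Q': "Q' \<in> carrier_mat d d"
    unfolding P'_def Q'_def using Ui(1) Pc Qc by (simp_all add: square_mult_carrier_mat)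
  have D: "P' - Q' = real_diag d l"
    unfolding P'_def Q'_def unitary_conj_minus[OF Ui(1) Pc Qc, symmetric] H
    by (rule unitary_conj_diag_cancel[OF U])
  have sq: "(mat_adjoint U * A * U) * (mat_adjoint U * A * U) = mat_adjoint U * (A * A) * U"
    if A: "A \<in> carrier_mat d d" for A
  proof -
    have "(mat_adjoint U * A * U) * (mat_adjoint U * A * U) = mat_adjoint U * (A * ((U * mat_adjoint U) * (A * U)))"
      using Ui(1) A by (simp add: square_assoc_mult[of _ d] square_mult_carrier_mat)
    also have "\<dots> = mat_adjoint U * (A * A) * U"
      using Ui(1) A by (simp add: Ui(4) left_mult_one_mat[of _ d d] square_assoc_mult[of _ d] square_mult_carrier_mat)
    finally show ?thesis .
  qed
  have eq': "P' * P' = Q' * Q'" unfolding P'_def Q'_def sq[OF Pc] sq[OF Qc] eq ..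
  have "l s = 0" if s: "s < d" for s
  proof -
    have Dij: "P' $$ (i, j) = Q' $$ (i, j) + (if i = j then of_real (l i) else 0)" if "i < d" "j < d" for i j
      using arg_cong[OF D, of "\<lambda>M. M $$ (i, j)"] that P' Q' by (auto simp: real_diag_def algebra_simps)
    have "(\<Sum>i<d. P' $$ (s, i) * P' $$ (i, s)) = (\<Sum>i<d. Q' $$ (s, i) * Q' $$ (i, s))"
      using arg_cong[OF eq', of "\<lambda>M. M $$ (s, s)"]
      unfolding index_mult_mat_sum[OF P' P' s s] index_mult_mat_sum[OF Q' Q' s s] .
    moreover have "(\<Sum>i<d. P' $$ (s, i) * P' $$ (i, s)) =
      (\<Sum>i<d. Q' $$ (s, i) * Q' $$ (i, s) + (if i = s then of_real (l s) * (P' $$ (s, s) + Q' $$ (s, s)) else 0))"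
      using s by (intro sum.cong) (auto simp: Dij algebra_simps)
    ultimately have "of_real (l s) * (P' $$ (s, s) + Q' $$ (s, s)) = 0"
      using s by (simp add: sum.distrib)
    hence "l s = 0 \<or> Re (P' $$ (s, s)) + Re (Q' $$ (s, s)) = 0"
      by (metis mult_eq_0_iff of_real_eq_0_iff plus_complex.sel(1) zero_complex.sel(1))
    \<comment> \<open>If the sum of these two nonnegative numbers is zero, both vanish, and so does
      their difference \<open>l s\<close>.\<close>
    moreover have "Re (P' $$ (s, s)) \<ge> 0" "Re (Q' $$ (s, s)) \<ge> 0"
      unfolding P'_def Q'_def using psd_mat_unitary_conj_diag(2) P Q Ui(1) s by auto
    moreover have "Re (P' $$ (s, s)) = Re (Q' $$ (s, s)) + l s" using Dij[OF s s] by simp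
    ultimately show "l s = 0" by linarith
  qed
  hence "P - Q = 0\<^sub>m d d" unfolding H using Ui(1)
    by (intro eq_matI) (auto simp: unitary_conj_diag_index simp del: index_mult_mat(1))
  show ?thesis
  proof (rule eq_matI)
    fix i j assume "i < dim_row Q" "j < dim_col Q"
    thus "P $$ (i, j) = Q $$ (i, j)"
      using arg_cong[OF \<open>P - Q = 0\<^sub>m d d\<close>, of "\<lambda>M. M $$ (i, j)"] Pc Qc by auto
  qed (use Pc Qc in auto)
qed

text \<open>Replacing each \<open>l s\<close> by its modulus gives a positive square root of
  \<open>A* A\<close>. Uniqueness of such roots is what lets the definite description in
  \<open>mat_abs\<close> be evaluated.\<close>

lemma trace_norm_eq_sum_eigenvalues:
  assumes U: "unitary_mat d U"
  shows "trace_norm (U * real_diag d l * mat_adjoint U) = (\<Sum>s<d. \<bar>l s\<bar>)"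
proof -
  note Ui = unitary_mat_inverse[OF U]
  let ?A = "U * real_diag d l * mat_adjoint U"
  let ?P = "U * real_diag d (\<lambda>s. \<bar>l s\<bar>) * mat_adjoint U"
  have A: "?A \<in> carrier_mat d d" using Ui(1) by (simp add: square_mult_carrier_mat)
  note herm = unitary_conj_diag_hermitian[OF Ui(1), of l]
  have dimA: "dim_col ?A = d" using A by (rule carrier_matD(2))
  have P: "psd_mat d ?P" by (rule unitary_conj_diag_psd[OF Ui(1)]) simp
  have PP: "?P * ?P = mat_adjoint ?A * ?A"
    unfolding herm unitary_conj_diag_square[OF U] by simp
  have "mat_abs ?A = ?P"
    unfolding mat_abs_def
  proof (rule the_equality)
    show "psd_mat (dim_col ?A) ?P \<and> ?P * ?P = mat_adjoint ?A * ?A" unfolding dimA using P PP by (rule conjI)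
    fix R assume "psd_mat (dim_col ?A) R \<and> R * R = mat_adjoint ?A * ?A"
    thus "R = ?P" unfolding dimA using psd_mat_square_root_unique[of d R ?P] P PP by metis
  qed
  thus ?thesis unfolding trace_norm_def unitary_conj_diag_trace[OF U] by (simp add: unitary_conj_diag_trace[OF U])
qed

text \<open>If \<open>l s\<close> are the eigenvalues of the difference, those of \<open>R\<close>
  are \<open>l s + \<beta>\<close>, hence nonnegative. Then
  \<open>\<bar>l s\<bar> \<le> (l s + \<beta>) + \<beta>\<close>, and summing over \<open>s\<close>
  turns the first summands into the trace of \<open>R\<close>.\<close>

theorem trace_norm_psd_minus_scalar_le:
  assumes R: "psd_mat d R" and "\<beta> \<ge> 0"
  shows "trace_norm (R - of_real \<beta> \<cdot>\<^sub>m 1\<^sub>m d) \<le> Re (mat_trace R) + \<beta> * real d"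
proof -
  let ?X = "R - of_real \<beta> \<cdot>\<^sub>m 1\<^sub>m d"
  have Rc: "R \<in> carrier_mat d d" and Rh: "mat_adjoint R = R" using R unfolding psd_mat_def by auto
  have X: "?X \<in> carrier_mat d d" by (intro minus_carrier_mat smult_carrier_mat one_carrier_mat)
  have "mat_adjoint (complex_of_real \<beta> \<cdot>\<^sub>m 1\<^sub>m d) = of_real \<beta> \<cdot>\<^sub>m 1\<^sub>m d" by (intro eq_matI) auto
  hence "mat_adjoint ?X = ?X" using mat_adjoint_minus[OF Rc, of "of_real \<beta> \<cdot>\<^sub>m 1\<^sub>m d"] Rh by simp
  then obtain U l where U: "unitary_mat d U" and Xd: "?X = U * real_diag d l * mat_adjoint U"
    using hermitian_spectral_decomposition[OF X] by metis
  note Ui = unitary_mat_inverse[OF U]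
  \<comment> \<open>The scalar matrix is diagonal in every orthonormal basis, so adding it back only
    shifts the eigenvalues.\<close>
  have RX: "R = U * real_diag d (\<lambda>s. l s + \<beta>) * mat_adjoint U"
  proof (rule eq_matI)
    fix i j assume "i < dim_row (U * real_diag d (\<lambda>s. l s + \<beta>) * mat_adjoint U)"
      "j < dim_col (U * real_diag d (\<lambda>s. l s + \<beta>) * mat_adjoint U)"
    hence ij: "i < d" "j < d" using Ui(1) by auto
    have "(\<Sum>s<d. U $$ (i, s) * cnj (U $$ (j, s))) = (U * mat_adjoint U) $$ (i, j)"
      using index_mult_mat_sum[OF Ui(1,2) ij] ij Ui(1) by simp
    also have "\<dots> = (if i = j then 1 else 0)" using Ui(4) ij by simp
    finally have *: "(\<Sum>s<d. of_real \<beta> * U $$ (i, s) * cnj (U $$ (j, s))) = of_real \<beta> * (if i = j then 1 else 0)"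
      by (simp add: mult.assoc flip: sum_distrib_left)
    have "R $$ (i, j) = ?X $$ (i, j) + of_real \<beta> * (if i = j then 1 else 0)" using ij Rc by simp
    also have "\<dots> = (\<Sum>s<d. of_real (l s) * U $$ (i, s) * cnj (U $$ (j, s))) + (\<Sum>s<d. of_real \<beta> * U $$ (i, s) * cnj (U $$ (j, s)))"
      unfolding Xd unitary_conj_diag_index[OF Ui(1) ij] * ..
    finally show "R $$ (i, j) = (U * real_diag d (\<lambda>s. l s + \<beta>) * mat_adjoint U) $$ (i, j)"
      unfolding unitary_conj_diag_index[OF Ui(1) ij] by (simp add: algebra_simps sum.distrib)
  qed (use Rc Ui(1) in auto)
  have pos: "l s + \<beta> \<ge> 0" if "s < d" for s
    using psd_mat_unitary_conj_diag(2)[OF R Ui(1) that] that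
    unfolding arg_cong[OF RX, of "\<lambda>M. mat_adjoint U * M * U"] unitary_conj_diag_cancel[OF U] by (simp add: real_diag_def)
  have "trace_norm ?X = (\<Sum>s<d. \<bar>l s\<bar>)" unfolding Xd by (rule trace_norm_eq_sum_eigenvalues[OF U])
  also have "\<dots> \<le> (\<Sum>s<d. (l s + \<beta>) + \<beta>)"
    using pos \<open>\<beta> \<ge> 0\<close> by (intro sum_mono) (simp add: abs_le_iff, smt (verit))
  also have "\<dots> = Re (mat_trace R) + \<beta> * real d"
    by (subst RX, subst unitary_conj_diag_trace[OF U]) (simp add: sum.distrib)
  finally show ?thesis .
qed

section \<open>Strings and multiplicities\<close>

definition cnt :: "nat \<Rightarrow> (nat \<Rightarrow> nat) \<Rightarrow> nat \<Rightarrow> nat" where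
  "cnt n f s = card {k. k < n \<and> f k = s}"

text \<open>Extensional functions are used so that strings agreeing on all \<open>n\<close>
  positions are equal and the set of strings is finite.\<close>

abbreviation strs :: "nat \<Rightarrow> nat \<Rightarrow> (nat \<Rightarrow> nat) set" where
  "strs n d \<equiv> {..<n} \<rightarrow>\<^sub>E {..<d}"

text \<open>For a string in \<open>strs n d\<close> this is the number of permutations of the
  \<open>n\<close> positions that fix it.\<close>

definition cnt_fact :: "nat \<Rightarrow> nat \<Rightarrow> (nat \<Rightarrow> nat) \<Rightarrow> nat" where
  "cnt_fact n d f = (\<Prod>s<d. fact (cnt n f s))"

lemma cnt_le: "cnt n f s \<le> n"
proof -
  have "cnt n f s \<le> card {..<n}" unfolding cnt_def by (intro card_mono) auto
  thus ?thesis by simp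
qed

lemma cnt_pos: "k < n \<Longrightarrow> cnt n f (f k) > 0"
  unfolding cnt_def by (subst card_gt_0_iff) auto

lemma cnt_0_Suc: "cnt 0 f s = 0"
  "cnt (Suc n) f s = cnt n f s + (if f n = s then 1 else 0)"
proof -
  show "cnt 0 f s = 0" by (simp add: cnt_def)
  have "{k. k < Suc n \<and> f k = s} = {k. k < n \<and> f k = s} \<union> (if f n = s then {n} else {})"
    by (auto simp: less_Suc_eq)
  thus "cnt (Suc n) f s = cnt n f s + (if f n = s then 1 else 0)"
    unfolding cnt_def by (subst card_Un_disjoint[symmetric] | simp)+
qed

lemma cnt_cong: "(\<And>k. k < n \<Longrightarrow> f k = g k) \<Longrightarrow> cnt n f = cnt n g"
  unfolding cnt_def by (intro ext arg_cong[of _ _ card]) auto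

lemma sum_cnt: "(\<And>k. k < n \<Longrightarrow> f k < d) \<Longrightarrow> (\<Sum>s<d. cnt n f s) = n"
proof (induction n)
  case (Suc n)
  thus ?case by (simp add: cnt_0_Suc sum.distrib)
qed (simp add: cnt_0_Suc)

lemma strs_Suc: "bij_betw (\<lambda>(s, f). f(n := s)) ({..<d} \<times> strs n d) (strs (Suc n) d)"
proof -
  have "inj_on (\<lambda>(s, f). f(n := s)) ({..<d} \<times> strs n d)"
    by (rule inj_combinator) simp
  moreover have "strs (Suc n) d = (\<lambda>(s, f). f(n := s)) ` ({..<d} \<times> strs n d)"
    unfolding lessThan_Suc by (rule PiE_insert_eq)
  ultimately show ?thesis unfolding bij_betw_def by simp
qed

text \<open>Appending the symbol \<open>s\<close> multiplies \<open>cnt_fact\<close> by one more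
  than the multiplicity of \<open>s\<close>. Over all \<open>s\<close> these factors add up to
  \<open>d + n\<close>, since the multiplicities add up to the length.\<close>

lemma sum_cnt_fact: "(\<Sum>f\<in>strs n d. cnt_fact n d f) = (\<Prod>i<n. d + i)"
proof (induction n)
  case 0
  show ?case by (simp add: cnt_fact_def cnt_0_Suc)
next
  case (Suc n)
  have step: "cnt_fact (Suc n) d (f(n := s)) = cnt_fact n d f * Suc (cnt n f s)" if "s < d" for f s
  proof -
    have c: "cnt n (f(n := s)) = cnt n f" by (rule cnt_cong) simp
    have "cnt_fact (Suc n) d (f(n := s)) = (\<Prod>t<d. fact (cnt n f t) * (if s = t then Suc (cnt n f s) else 1))"
      unfolding cnt_fact_def cnt_0_Suc c by (intro prod.cong) (auto simp: mult_ac)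
    also have "\<dots> = cnt_fact n d f * Suc (cnt n f s)"
      unfolding cnt_fact_def prod.distrib using that by (simp add: prod.delta)
    finally show ?thesis .
  qed
  have "(\<Sum>f\<in>strs (Suc n) d. cnt_fact (Suc n) d f) = (\<Sum>(s, f)\<in>{..<d} \<times> strs n d. cnt_fact (Suc n) d (f(n := s)))"
    by (subst sum.reindex_bij_betw[OF strs_Suc, symmetric]) (simp add: case_prod_unfold)
  also have "\<dots> = (\<Sum>f\<in>strs n d. \<Sum>s<d. cnt_fact n d f * Suc (cnt n f s))"
    by (subst sum.cartesian_product[symmetric], subst sum.swap) (simp add: step)
  also have "\<dots> = (\<Sum>f\<in>strs n d. cnt_fact n d f * (d + n))"
  proof (rule sum.cong)
    fix f assume "f \<in> strs n d"
    hence "(\<Sum>s<d. cnt n f s) = n" by (intro sum_cnt) auto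
    thus "(\<Sum>s<d. cnt_fact n d f * Suc (cnt n f s)) = cnt_fact n d f * (d + n)"
      by (simp add: sum_distrib_left[symmetric] sum.distrib del: mult_Suc_right) (simp add: sum_Suc)
  qed simp
  finally show ?case using Suc by (simp flip: sum_distrib_right)
qed

lemma cnt_fact_pos: "cnt_fact n d f \<ge> 1"
  unfolding cnt_fact_def by (simp add: Suc_leI prod_pos)

lemma cnt_fun_upd:
  assumes k: "k < n" and a: "h k = a" and b: "b \<noteq> a"
  shows "cnt n (h(k := b)) s = (if s = a then cnt n h a - 1 else if s = b then cnt n h b + 1 else cnt n h s)"
proof -
  have 1: "{j. j < n \<and> (h(k := b)) j = a} = {j. j < n \<and> h j = a} - {k}" using a b by auto
  have 2: "{j. j < n \<and> (h(k := b)) j = b} = insert k {j. j < n \<and> h j = b}" using k by auto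
  have 3: "{j. j < n \<and> (h(k := b)) j = s} = {j. j < n \<and> h j = s}" if "s \<noteq> a" "s \<noteq> b" using that a by auto
  show ?thesis unfolding cnt_def using 1 2 3 k a b by (auto simp del: fun_upd_apply)
qed

text \<open>Only two factorials change: that of \<open>a\<close> loses its top factor
  \<open>cnt n h a\<close>, and that of the fresh symbol \<open>b\<close> passes from 0! to 1!, both
  of which are 1.\<close>

lemma cnt_fact_fun_upd:
  assumes k: "k < n" and a: "h k = a" "a < d" and b: "b \<noteq> a" "b < d" "cnt n h b = 0"
  shows "cnt n h a * cnt_fact n d (h(k := b)) = cnt_fact n d h"
proof -
  have split: "(\<Prod>s<d. fact (F s)) = fact (F a) * (fact (F b) * (\<Prod>s\<in>{..<d} - {a} - {b}. fact (F s)))"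
    for F :: "nat \<Rightarrow> nat"
    using a b by (subst prod.remove[of _ a], simp, simp, subst prod.remove[of _ b]) auto
  have "cnt n h a > 0" using cnt_pos[OF k, of h] a by simp
  hence f: "fact (cnt n h a) = cnt n h a * (fact (cnt n h a - 1) :: nat)" by (subst fact_reduce) auto
  have "(\<Prod>s\<in>{..<d} - {a} - {b}. fact (cnt n (h(k := b)) s)) = (\<Prod>s\<in>{..<d} - {a} - {b}. fact (cnt n h s))"
    using k a b by (intro prod.cong) (auto simp: cnt_fun_upd)
  thus ?thesis unfolding cnt_fact_def split using k a b by (simp add: cnt_fun_upd f)
qed

section \<open>Numerical estimates for the bound\<close>

text \<open>The lower estimate is Bernoulli's inequality. For the upper one, passing from
  \<open>m\<close> to \<open>m + 1\<close> multiplies the remainder by \<open>1 - x\<close> and adds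
  \<open>m * x\<^sup>2\<close>, which fits into the growth of
  \<open>(m * x)\<^sup>2\<close>.\<close>

lemma linear_approx_power:
  fixes x :: real
  assumes "0 \<le> x" "x \<le> 1"
  shows "0 \<le> (1 - x) ^ m - 1 + m * x" "(1 - x) ^ m - 1 + m * x \<le> (real m * x)\<^sup>2"
proof -
  have "1 + real m * (- x) \<le> (1 + - x) ^ m" using assms by (intro Bernoulli_inequality) simp
  thus lower: "0 \<le> (1 - x) ^ m - 1 + m * x" by simp
  show "(1 - x) ^ m - 1 + m * x \<le> (real m * x)\<^sup>2"
  proof (induction m)
    case (Suc m)
    have "(1 - x) ^ Suc m - 1 + Suc m * x = ((1 - x) ^ m - 1 + m * x) * (1 - x) + m * x\<^sup>2"
      by (simp add: algebra_simps power2_eq_square)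
    also have "\<dots> \<le> (real m * x)\<^sup>2 * 1 + m * x\<^sup>2"
      using Suc assms by (intro add_right_mono mult_mono) auto
    also have "\<dots> \<le> (real (Suc m) * x)\<^sup>2"
      using assms by (simp add: power2_eq_square algebra_simps)
    finally show ?case .
  qed simp
qed

text \<open>This is the O-term, read as one constant for all pairs \<open>m \<le> r\<close>. With
  \<open>x = (m - 1) / r\<close> the base of the power is \<open>1 - x\<close>, and the remainder
  after the linear term is at most \<open>(m * x)\<^sup>2\<close>, hence at most
  \<open>m ^ 4 / r ^ 2\<close>.\<close>

lemma bound_asymptotics:
  "\<exists>C::real. \<forall>m r :: nat. 0 < m \<and> m \<le> r \<longrightarrow>
           \<bar>(2 - 2 * ((real r - real m + 1) / real r) ^ m) - 2 * real m * (real m - 1) / real r\<bar>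
             \<le> C * real m ^ 4 / (real r) ^ 2"
\<comment> \<open>The constant 2 is the factor in front of the power.\<close>
proof (intro exI[of _ 2] allI impI)
  fix m r :: nat assume mr: "0 < m \<and> m \<le> r"
  define x where "x = (real m - 1) / real r"
  have x: "0 \<le> x" "x \<le> 1" "x \<le> real m / real r" unfolding x_def using mr by (auto simp: field_simps)
  have e: "(real r - real m + 1) / real r = 1 - x" unfolding x_def using mr by (simp add: field_simps)
  have "\<bar>(2 - 2 * (1 - x) ^ m) - 2 * real m * x\<bar> \<le> 2 * (real m * x)\<^sup>2"
    using linear_approx_power[OF x(1,2), of m] by (simp add: abs_le_iff)
  also have "\<dots> \<le> 2 * (real m * (real m / real r))\<^sup>2"
    using x by (intro mult_left_mono power_mono) auto
  also have "\<dots> = 2 * real m ^ 4 / (real r) ^ 2"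
    by (simp add: power2_eq_square power4_eq_xxxx)
  finally show "\<bar>(2 - 2 * ((real r - real m + 1) / real r) ^ m) - 2 * real m * (real m - 1) / real r\<bar>
             \<le> 2 * real m ^ 4 / (real r) ^ 2"
    unfolding e by (simp add: x_def)
qed

text \<open>Squaring pairs the factor \<open>i\<close> with the factor \<open>n - 1 - i\<close>; each pair dominates
  \<open>((q - n + 1) / q)\<^sup>2\<close>.\<close>
lemma falling_rising_ratio_ge:
  assumes "n \<le> q" "0 < p" "0 < n"
  shows "((real q - real n + 1) / real q) ^ n \<le>
    real p ^ n * (\<Prod>i<n. real (q - i)) / (\<Prod>i<n. real (p * q + i))"
proof -
  define N where "N = real n - 1"
  \<comment> \<open>These are the factors of the ratio in the case \<open>p = 1\<close>; larger
    \<open>p\<close> is treated at the end.\<close>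
  define g where "g i = (real q - real i) / (real q + real i)" for i :: nat
  have q: "real q > 0" using assms by simp
  have pair: "((real q - N) / real q)\<^sup>2 \<le> g i * g (n - 1 - i)" if "i < n" for i
  proof -
    define x y where "x = real i" and "y = real (n - 1 - i)"
    have xy: "x \<ge> 0" "y \<ge> 0" "x + y = N" "N < real q" using that assms unfolding x_def y_def N_def by auto
    have "((real q - N) / real q)\<^sup>2 \<le> (real q - N) / (real q + N)"
    proof -
      have "(real q - N) * (real q + N) \<le> (real q)\<^sup>2" by (simp add: algebra_simps power2_eq_square)
      hence "(real q - N) * ((real q - N) * (real q + N)) \<le> (real q - N) * (real q)\<^sup>2"
        using xy by (intro mult_left_mono) auto
      thus ?thesis using q xy by (simp add: field_simps power2_eq_square)
    qed
    \<comment> \<open>Since \<open>x + y = N\<close>, numerator and denominator exceed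
      \<open>q * (q - N)\<close> and \<open>q * (q + N)\<close> by the same amount
      \<open>x * y\<close>, which can only raise a fraction that is at most 1.\<close>
    also have "\<dots> \<le> ((real q - x) * (real q - y)) / ((real q + x) * (real q + y))"
    proof -
      have e: "(real q - x) * (real q - y) = real q * (real q - N) + x * y"
        "(real q + x) * (real q + y) = real q * (real q + N) + x * y"
        using xy(3) by (auto simp: algebra_simps)
      have "0 < real q * (real q + N) + x * y"
        using q xy by (intro add_pos_nonneg mult_pos_pos) auto
      moreover have "(real q - N) * (x * y) \<le> (real q + N) * (x * y)"
        using xy by (intro mult_right_mono) auto
      ultimately show ?thesis unfolding e using q xy
        by (simp add: frac_le_eq divide_le_0_iff algebra_simps)
    qed
    finally show ?thesis unfolding g_def x_def y_def by simp
  qed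
  have gpos: "g i \<ge> 0" if "i < n" for i using that assms unfolding g_def by auto
  have "(((real q - N) / real q) ^ n)\<^sup>2 = (\<Prod>i<n. ((real q - N) / real q)\<^sup>2)"
    by (simp add: power_mult[symmetric] mult.commute)
  also have "\<dots> \<le> (\<Prod>i<n. g i * g (n - 1 - i))" using pair by (intro prod_mono) auto
  also have "\<dots> = (\<Prod>i<n. g i) * (\<Prod>i<n. g (n - 1 - i))" by (rule prod.distrib)
  also have "(\<Prod>i<n. g (n - 1 - i)) = (\<Prod>i<n. g i)"
    using prod.nat_diff_reindex[of g n] by simp
  finally have "(((real q - N) / real q) ^ n)\<^sup>2 \<le> (\<Prod>i<n. g i)\<^sup>2"
    by (simp only: power2_eq_square)
  moreover have "0 \<le> (\<Prod>i<n. g i)" by (rule prod_nonneg) (use gpos in simp)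
  ultimately have "((real q - N) / real q) ^ n \<le> (\<Prod>i<n. g i)" by (rule power2_le_imp_le)
  \<comment> \<open>Because \<open>p * q + i \<le> p * (q + i)\<close>, every factor is at least its
    counterpart for \<open>p = 1\<close>.\<close>
  also have "\<dots> \<le> (\<Prod>i<n. real p * (real q - real i) / real (p * q + i))"
  proof (rule prod_mono, intro conjI gpos)
    fix i assume i: "i \<in> {..<n}"
    have "real i \<le> real p * real i" using assms by (simp add: mult_le_cancel_right1)
    hence "real (p * q + i) \<le> real p * (real q + real i)" by (simp add: algebra_simps)
    moreover have "0 < real (p * q + i)" unfolding of_nat_0_less_iff using assms by simp
    ultimately have "real p * (real q - real i) / (real p * (real q + real i)) \<le> real p * (real q - real i) / real (p * q + i)"
      using i assms by (intro divide_left_mono) auto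
    thus "g i \<le> real p * (real q - real i) / real (p * q + i)" unfolding g_def using assms by simp
  qed auto
  also have "\<dots> = real p ^ n * (\<Prod>i<n. real (q - i)) / (\<Prod>i<n. real (p * q + i))"
    using assms by (simp add: prod_dividef prod.distrib of_nat_diff)
  finally show ?thesis unfolding N_def by (simp add: algebra_simps)
qed

section \<open>Matrix entries of Werner states\<close>

text \<open>Position 0 is the least significant digit, in agreement with the index conventions of
  \<open>tensor_pow\<close> and \<open>pq_index\<close>.\<close>

definition enc :: "nat \<Rightarrow> nat \<Rightarrow> (nat \<Rightarrow> nat) \<Rightarrow> nat" where
  "enc d n f = (\<Sum>k<n. f k * d ^ k)"

lemma enc_Suc: "enc d (Suc n) f = f 0 + d * enc d n (\<lambda>k. f (Suc k))"
  unfolding enc_def sum.lessThan_Suc_shift by (simp add: sum_distrib_left mult_ac)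

lemma enc_digit:
  assumes "\<And>k. k < n \<Longrightarrow> f k < d" "j < n"
  shows "enc d n f div d ^ j mod d = f j"
  using assms
proof (induction n arbitrary: f j)
  case (Suc n)
  have d: "f 0 < d" using Suc.prems(1)[of 0] by simp
  show ?case
  proof (cases j)
    case 0
    thus ?thesis using d by (simp add: enc_Suc)
  next
    case (Suc i)
    have "(f 0 + d * enc d n (\<lambda>k. f (Suc k))) div d = enc d n (\<lambda>k. f (Suc k))"
      using d by simp
    hence "enc d (Suc n) f div d ^ j = enc d n (\<lambda>k. f (Suc k)) div d ^ i"
      unfolding Suc enc_Suc power_Suc by (simp add: div_mult2_eq)
    thus ?thesis using Suc.IH[of "\<lambda>k. f (Suc k)" i] Suc.prems Suc by simp
  qed
qed simp

lemma enc_less: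
  assumes "\<And>k. k < n \<Longrightarrow> f k < d"
  shows "enc d n f < d ^ n"
  using assms
proof (induction n arbitrary: f)
  case (Suc n)
  have "f 0 < d" using Suc.prems[of 0] by simp
  have "enc d n (\<lambda>k. f (Suc k)) + 1 \<le> d ^ n" using Suc.IH[of "\<lambda>k. f (Suc k)"] Suc.prems by fastforce
  hence "d * (enc d n (\<lambda>k. f (Suc k)) + 1) \<le> d * d ^ n" by (rule mult_le_mono2)
  thus ?case using \<open>f 0 < d\<close> by (simp add: enc_Suc)
qed (simp add: enc_def)

lemma enc_cong: "(\<And>k. k < n \<Longrightarrow> f k = g k) \<Longrightarrow> enc d n f = enc d n g"
  unfolding enc_def by (intro sum.cong) auto

text \<open>A string is recovered from the digits of its code; surjectivity follows by
  counting.\<close>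

lemma bij_betw_enc: "bij_betw (enc d n) (strs n d) {..<d ^ n}"
proof -
  have inj: "inj_on (enc d n) (strs n d)"
  proof (rule inj_onI)
    fix f g assume fg: "f \<in> strs n d" "g \<in> strs n d" and e: "enc d n f = enc d n g"
    show "f = g"
    proof (rule PiE_ext[OF fg])
      fix k assume "k \<in> {..<n}"
      hence k: "k < n" by simp
      have "f k = enc d n f div d ^ k mod d" using fg k by (subst enc_digit) auto
      also have "\<dots> = g k" unfolding e using fg k by (subst enc_digit) auto
      finally show "f k = g k" .
    qed
  qed
  moreover have "enc d n ` strs n d = {..<d ^ n}"
  proof (rule card_subset_eq)
    show "enc d n ` strs n d \<subseteq> {..<d ^ n}" by (auto intro!: enc_less)
    show "card (enc d n ` strs n d) = card {..<d ^ n}"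
      unfolding card_image[OF inj] by (simp add: card_funcsetE)
  qed simp
  ultimately show ?thesis unfolding bij_betw_def by simp
qed

lemma sum_enc: "(\<Sum>i<d ^ n. F i) = (\<Sum>f\<in>strs n d. F (enc d n f))"
  using sum.reindex_bij_betw[OF bij_betw_enc, of F d n] by simp

lemma finite_strs [simp]: "finite (strs n d)"
  by (rule finite_PiE) auto

lemma strsD [dest]: "f \<in> strs n d \<Longrightarrow> k < n \<Longrightarrow> f k < d"
  by auto

lemma strs_fun_upd: "f \<in> strs n d \<Longrightarrow> k < n \<Longrightarrow> t < d \<Longrightarrow> f(k := t) \<in> strs n d"
  by (auto simp: PiE_iff extensional_def)

lemma enc_strs_less: "f \<in> strs n d \<Longrightarrow> enc d n f < d ^ n"
  by (rule enc_less) auto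

section \<open>Tensor powers of unitary matrices\<close>

lemma tensor_pow_carrier [simp]: "tensor_pow n d U \<in> carrier_mat (d ^ n) (d ^ n)"
  unfolding tensor_pow_def by simp

lemma tensor_pow_enc:
  assumes "f \<in> strs n d" "g \<in> strs n d"
  shows "tensor_pow n d U $$ (enc d n f, enc d n g) = (\<Prod>k<n. U $$ (f k, g k))"
proof -
  have "enc d n f div d ^ k mod d = f k" "enc d n g div d ^ k mod d = g k" if "k < n" for k
    using assms that by (auto intro!: enc_digit simp: strsD)
  thus ?thesis unfolding tensor_pow_def using enc_strs_less[OF assms(1)] enc_strs_less[OF assms(2)] by simp
qed

text \<open>Distinct strings differ at some position, and the factor there is zero. This is how
  tensor powers of diagonal and permutation matrices are evaluated.\<close>

lemma prod_delta_strs: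
  fixes c :: "nat \<Rightarrow> 'a :: comm_semiring_1"
  assumes "f \<in> strs n d" "g \<in> strs n d"
  shows "(\<Prod>k<n. if f k = g k then c k else 0) = (if f = g then \<Prod>k<n. c k else 0)"
proof (cases "f = g")
  case False
  then obtain k where "k < n" "f k \<noteq> g k" using PiE_ext[OF assms] by auto
  thus ?thesis using False by (auto intro!: prod_zero)
qed simp

text \<open>By distributivity a sum over strings of a product over positions is a product of sums
  over symbols, so the orthonormality relations of \<open>U\<close> multiply position by
  position.\<close>

lemma unitary_tensor_pow:
  assumes "unitary_mat d U"
  shows "unitary_mat (d ^ n) (tensor_pow n d U)"
proof -
  note Ui = unitary_mat_inverse[OF assms]
  let ?T = "tensor_pow n d U"
  have T: "?T \<in> carrier_mat (d ^ n) (d ^ n)" by simp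
  have Uprod: "(\<Sum>s<d. cnj (U $$ (s, i)) * U $$ (s, j)) = (if i = j then 1 else 0)"
    if "i < d" "j < d" for i j
  proof -
    have "(mat_adjoint U * U) $$ (i, j) = (\<Sum>s<d. cnj (U $$ (s, i)) * U $$ (s, j))"
      using index_mult_mat_sum[OF Ui(2,1) that] that Ui(1) by simp
    thus ?thesis using Ui(3) that by simp
  qed
  have "mat_adjoint ?T * ?T = 1\<^sub>m (d ^ n)"
  proof (rule eq_matI)
    fix i j assume "i < dim_row (1\<^sub>m (d ^ n) :: complex mat)" "j < dim_col (1\<^sub>m (d ^ n) :: complex mat)"
    hence ij: "i < d ^ n" "j < d ^ n" by auto
    hence "i \<in> enc d n ` strs n d" "j \<in> enc d n ` strs n d"
      unfolding bij_betw_imp_surj_on[OF bij_betw_enc] by simp_all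
    then obtain f g where f: "f \<in> strs n d" "i = enc d n f" and g: "g \<in> strs n d" "j = enc d n g"
      by (elim imageE) simp
    have eq: "enc d n f = enc d n g \<longleftrightarrow> f = g"
      by (rule inj_on_eq_iff[OF bij_betw_imp_inj_on[OF bij_betw_enc] f(1) g(1)])
    have "(mat_adjoint ?T * ?T) $$ (i, j) = (\<Sum>s<d ^ n. mat_adjoint ?T $$ (i, s) * ?T $$ (s, j))"
      by (rule index_mult_mat_sum[OF mat_adjoint_carrier[OF T] T ij])
    also have "\<dots> = (\<Sum>s<d ^ n. cnj (?T $$ (s, i)) * ?T $$ (s, j))"
      using ij carrier_matD[OF T] by (intro sum.cong refl) (subst mat_adjoint_index; simp)
    also have "\<dots> = (\<Sum>h\<in>strs n d. \<Prod>k<n. cnj (U $$ (h k, f k)) * U $$ (h k, g k))"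
      unfolding sum_enc f(2) g(2) by (intro sum.cong refl) (simp add: tensor_pow_enc f(1) g(1) prod.distrib)
    also have "\<dots> = (\<Prod>k<n. \<Sum>s<d. cnj (U $$ (s, f k)) * U $$ (s, g k))"
      by (subst prod_sum_PiE) auto
    also have "\<dots> = (\<Prod>k<n. if f k = g k then 1 else 0)"
      using f(1) g(1) by (intro prod.cong) (auto simp: Uprod strsD)
    also have "\<dots> = 1\<^sub>m (d ^ n) $$ (i, j)"
      unfolding prod_delta_strs[OF f(1) g(1)] using ij eq f(2) g(2) by simp
    finally show "(mat_adjoint ?T * ?T) $$ (i, j) = 1\<^sub>m (d ^ n) $$ (i, j)" .
  qed (use carrier_matD[OF T] in auto)
  thus ?thesis unfolding unitary_mat_def using T by simp
qed

lemma unitary_mat_matI: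
  assumes "\<And>i j. i < d \<Longrightarrow> j < d \<Longrightarrow> (\<Sum>s<d. cnj (u s i) * u s j) = (if i = j then 1 else 0)"
  shows "unitary_mat d (mat d d (\<lambda>(i, j). u i j))"
proof -
  let ?U = "mat d d (\<lambda>(i, j). u i j)"
  have U: "?U \<in> carrier_mat d d" by simp
  have "mat_adjoint ?U * ?U = 1\<^sub>m d"
  proof (rule eq_matI)
    fix i j assume "i < dim_row (1\<^sub>m d :: complex mat)" "j < dim_col (1\<^sub>m d :: complex mat)"
    hence ij: "i < d" "j < d" by auto
    show "(mat_adjoint ?U * ?U) $$ (i, j) = 1\<^sub>m d $$ (i, j)"
      unfolding index_mult_mat_sum[OF mat_adjoint_carrier[OF U] U ij] using ij assms[OF ij] by simp
  qed auto
  thus ?thesis unfolding unitary_mat_def by simp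
qed

section \<open>Consequences of positivity and invariance for the entries\<close>

locale werner =
  fixes d n :: nat and \<rho> :: "complex mat"
  assumes werner: "werner_state d n \<rho>"
begin

abbreviation S where "S \<equiv> strs n d"

text \<open>The arguments are arbitrary functions, of which only the first \<open>n\<close> values
  matter; symbols can thus be permuted pointwise without restricting the result.\<close>

definition r :: "(nat \<Rightarrow> nat) \<Rightarrow> (nat \<Rightarrow> nat) \<Rightarrow> complex" where
  "r f g = \<rho> $$ (enc d n f, enc d n g)"

lemma \<rho>_psd: "psd_mat (d ^ n) \<rho>"
  and \<rho>_carrier: "\<rho> \<in> carrier_mat (d ^ n) (d ^ n)"
  and \<rho>_trace: "mat_trace \<rho> = 1"
  using werner unfolding werner_state_def density_op_def psd_mat_def by auto

lemma r_cong: "(\<And>k. k < n \<Longrightarrow> f k = f' k) \<Longrightarrow> (\<And>k. k < n \<Longrightarrow> g k = g' k) \<Longrightarrow> r f g = r f' g'"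
  unfolding r_def using enc_cong[of n f f'] enc_cong[of n g g'] by simp

lemma r_hermitian:
  assumes "f \<in> S" "g \<in> S"
  shows "r g f = cnj (r f g)"
  using \<rho>_psd \<rho>_carrier mat_adjoint_index[of "enc d n g" \<rho> "enc d n f"]
    enc_strs_less[OF assms(1)] enc_strs_less[OF assms(2)]
  unfolding psd_mat_def r_def by simp

lemma r_trace: "(\<Sum>f\<in>S. r f f) = 1"
  using \<rho>_trace \<rho>_carrier unfolding mat_trace_def r_def by (simp add: sum_enc)

text \<open>The form is tested on the combination of the basis vectors \<open>\<phi> a\<close> with
  coefficients \<open>x a\<close>. Since \<open>\<phi>\<close> may repeat a string, the vector
  \<open>v\<close> adds up all coefficients that belong to the same index.\<close>

lemma r_psd:
  fixes x :: "'i \<Rightarrow> complex"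
  assumes I: "finite I" and \<phi>: "\<And>a. a \<in> I \<Longrightarrow> \<phi> a \<in> S"
  shows "Im (\<Sum>a\<in>I. \<Sum>b\<in>I. cnj (x a) * r (\<phi> a) (\<phi> b) * x b) = 0"
    and "0 \<le> Re (\<Sum>a\<in>I. \<Sum>b\<in>I. cnj (x a) * r (\<phi> a) (\<phi> b) * x b)"
proof -
  define v where "v = vec (d ^ n) (\<lambda>i. \<Sum>a\<in>I. if enc d n (\<phi> a) = i then x a else 0)"
  have v: "v \<in> carrier_vec (d ^ n)" unfolding v_def by simp
  have lt: "enc d n (\<phi> a) < d ^ n" if "a \<in> I" for a using enc_strs_less \<phi> that by blast
  have ev: "(\<Sum>i<d ^ n. v $ i * G i) = (\<Sum>a\<in>I. x a * G (enc d n (\<phi> a)))" for G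
  proof -
    have "(\<Sum>i<d ^ n. v $ i * G i) = (\<Sum>i<d ^ n. \<Sum>a\<in>I. if enc d n (\<phi> a) = i then x a * G i else 0)"
      unfolding v_def by (auto simp: sum_distrib_right intro!: sum.cong)
    also have "\<dots> = (\<Sum>a\<in>I. x a * G (enc d n (\<phi> a)))"
      by (subst sum.swap) (auto simp: lt intro!: sum.cong)
    finally show ?thesis .
  qed
  have ev': "(\<Sum>i<d ^ n. cnj (v $ i) * G i) = (\<Sum>a\<in>I. cnj (x a) * G (enc d n (\<phi> a)))" for G
    using arg_cong[OF ev[of "\<lambda>i. cnj (G i)"], of cnj] by simp
  have "(\<Sum>i<d ^ n. cnj (v $ i) * (\<rho> *\<^sub>v v) $ i) = (\<Sum>i<d ^ n. cnj (v $ i) * (\<Sum>j<d ^ n. v $ j * \<rho> $$ (i, j)))"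
    unfolding quadratic_form_sum[OF \<rho>_carrier v] by (simp add: sum_distrib_left mult_ac)
  also have "\<dots> = (\<Sum>a\<in>I. \<Sum>b\<in>I. cnj (x a) * r (\<phi> a) (\<phi> b) * x b)"
    unfolding ev ev' r_def by (simp add: sum_distrib_left mult_ac)
  finally have eq: "(\<Sum>i<d ^ n. cnj (v $ i) * (\<rho> *\<^sub>v v) $ i) = (\<Sum>a\<in>I. \<Sum>b\<in>I. cnj (x a) * r (\<phi> a) (\<phi> b) * x b)" .
  show "Im (\<Sum>a\<in>I. \<Sum>b\<in>I. cnj (x a) * r (\<phi> a) (\<phi> b) * x b) = 0"
    "0 \<le> Re (\<Sum>a\<in>I. \<Sum>b\<in>I. cnj (x a) * r (\<phi> a) (\<phi> b) * x b)"
    using \<rho>_psd v unfolding psd_mat_def eq[symmetric] by blast+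
qed

lemma r_diag_nonneg:
  assumes "f \<in> S"
  shows "0 \<le> Re (r f f)" "Im (r f f) = 0"
  using r_psd[of "{()}" "\<lambda>_. f" "\<lambda>_. 1"] assms by simp_all

text \<open>Positivity on the difference of the basis vectors \<open>f\<close> and \<open>g\<close>;
  by hermiticity the two cross terms together give twice the real part.\<close>

lemma r_offdiag_le:
  assumes "f \<in> S" "g \<in> S"
  shows "Re (r f g) \<le> (Re (r f f) + Re (r g g)) / 2"
proof -
  have "0 \<le> Re (\<Sum>a\<in>{True, False}. \<Sum>b\<in>{True, False}.
    cnj (if a then 1 else - 1) * r (if a then f else g) (if b then f else g) * (if b then 1 else - 1))"
    by (rule r_psd(2)) (use assms in auto)
  thus ?thesis using r_hermitian[OF assms] by simp
qed

text \<open>Invariance under conjugation by the unitary tensor power says that it commutes with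
  \<rho>; this is that relation entry by entry. A function \<open>u\<close> in place of a matrix
  keeps later uses free of matrix bookkeeping.\<close>

lemma r_comm:
  assumes u: "\<And>i j. i < d \<Longrightarrow> j < d \<Longrightarrow> (\<Sum>s<d. cnj (u s i) * u s j) = (if i = j then 1 else 0)"
    and f: "f \<in> S" and h: "h \<in> S"
  shows "(\<Sum>g\<in>S. (\<Prod>k<n. u (f k) (g k)) * r g h) = (\<Sum>g\<in>S. r f g * (\<Prod>k<n. u (g k) (h k)))"
proof -
  define U where "U = mat d d (\<lambda>(i, j). u i j)"
  have U: "unitary_mat d U" unfolding U_def by (rule unitary_mat_matI) (rule u)
  define T where "T = tensor_pow n d U"
  have T: "unitary_mat (d ^ n) T" unfolding T_def by (rule unitary_tensor_pow[OF U])
  note Ti = unitary_mat_inverse[OF T]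
  have inv: "T * \<rho> * mat_adjoint T = \<rho>" using werner U unfolding werner_state_def T_def by blast
  have "T * \<rho> = T * \<rho> * (mat_adjoint T * T)"
    using Ti(1) \<rho>_carrier unfolding Ti(3) by (simp add: square_mult_carrier_mat right_mult_one_mat[of _ "d ^ n" "d ^ n"])
  also have "\<dots> = T * \<rho> * mat_adjoint T * T"
    using Ti(1) \<rho>_carrier by (simp add: square_assoc_mult[of _ "d ^ n"] square_mult_carrier_mat)
  finally have comm: "T * \<rho> = \<rho> * T" unfolding inv .
  have Tfg: "T $$ (enc d n f, enc d n g) = (\<Prod>k<n. u (f k) (g k))" if "f \<in> S" "g \<in> S" for f g
    unfolding T_def tensor_pow_enc[OF that] using that by (intro prod.cong) (auto simp: U_def strsD)
  have "(\<Sum>g\<in>S. (\<Prod>k<n. u (f k) (g k)) * r g h) = (T * \<rho>) $$ (enc d n f, enc d n h)"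
    unfolding index_mult_mat_sum[OF Ti(1) \<rho>_carrier enc_strs_less[OF f] enc_strs_less[OF h]] sum_enc r_def
    using f by (simp add: Tfg)
  also have "\<dots> = (\<Sum>g\<in>S. r f g * (\<Prod>k<n. u (g k) (h k)))"
    unfolding comm index_mult_mat_sum[OF \<rho>_carrier Ti(1) enc_strs_less[OF f] enc_strs_less[OF h]] sum_enc r_def
    using h by (simp add: Tfg)
  finally show ?thesis .
qed

lemma prod_indicator_power_cnt:
  "(\<Prod>k<m. if f k = s then z else 1) = (z :: complex) ^ cnt m f s"
  by (induction m) (auto simp: cnt_0_Suc)

text \<open>The diagonal unitary with phase \<open>z\<close> at the symbol \<open>s\<close> turns
  commutation into \<open>z ^ cnt n f s * r f h = r f h * z ^ cnt n h s\<close>.\<close>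

lemma r_weight:
  assumes f: "f \<in> S" and h: "h \<in> S" and nz: "r f h \<noteq> 0"
  shows "cnt n f s = cnt n h s"
proof (cases "n = 0")
  case False
  \<comment> \<open>With angle \<open>1 / n\<close> the exponents 0 to \<open>n\<close> lead to
    angles between 0 and 1, where cosine is injective, so equal powers have equal exponents.\<close>
  define z where "z = cis (1 / real n)"
  define u where "u i j = (if i = j then (if i = s then z else 1) else 0)" for i j
  have z: "cnj z * z = 1" unfolding z_def by (simp add: cis_cnj cis_mult)
  have u: "(\<Sum>t<d. cnj (u t i) * u t j) = (if i = j then 1 else 0)" if "i < d" "j < d" for i j
  proof -
    have "(\<Sum>t<d. cnj (u t i) * u t j) = (\<Sum>t<d. if t = i then (if i = j then 1 else 0) else 0)"
      by (intro sum.cong) (auto simp: u_def z)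
    thus ?thesis using that by simp
  qed
  have pu: "(\<Prod>k<n. u (f k) (g k)) = (if f = g then z ^ cnt n f s else 0)" if "f \<in> S" "g \<in> S" for f g
    unfolding u_def prod_delta_strs[OF that] prod_indicator_power_cnt ..
  have "(\<Sum>g\<in>S. (\<Prod>k<n. u (f k) (g k)) * r g h) = (\<Sum>g\<in>S. if f = g then z ^ cnt n f s * r f h else 0)"
    using f by (intro sum.cong) (auto simp: pu)
  moreover have "(\<Sum>g\<in>S. r f g * (\<Prod>k<n. u (g k) (h k))) = (\<Sum>g\<in>S. if h = g then r f h * z ^ cnt n h s else 0)"
    using h by (intro sum.cong) (auto simp: pu)
  ultimately have "z ^ cnt n f s * r f h = r f h * z ^ cnt n h s"
    using r_comm[OF u f h] f h by (simp only: sum.delta' finite_strs if_True)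
  hence "z ^ cnt n f s = z ^ cnt n h s" using nz by simp
  hence "cos (real (cnt n f s) / real n) = cos (real (cnt n h s) / real n)"
    unfolding z_def DeMoivre by (simp add: complex_eq_iff)
  moreover have "real (cnt n g s) / real n \<le> pi" for g
  proof -
    have "real (cnt n g s) / real n \<le> 1" using cnt_le[of n g s] False by simp
    thus ?thesis using pi_ge_two by linarith
  qed
  ultimately have "real (cnt n f s) / real n = real (cnt n h s) / real n"
    using cos_inj_pi[of "real (cnt n f s) / real n" "real (cnt n h s) / real n"] by simp
  thus ?thesis using False by simp
qed (simp add: cnt_def)

text \<open>In the commutation relation for the permutation matrix of \<pi>, taken at the strings
  \<open>F\<close> (the image of \<open>f\<close>) and \<open>h\<close>, each side has a single
  nonzero term.\<close>

lemma r_permute: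
  assumes \<pi>: "bij_betw \<pi> {..<d} {..<d}" and f: "f \<in> S" and h: "h \<in> S"
  shows "r (\<lambda>k. \<pi> (f k)) (\<lambda>k. \<pi> (h k)) = r f h"
proof -
  define u where "u i j = (if i = \<pi> j then 1 else 0 :: complex)" for i j
  have lt: "\<pi> i < d" if "i < d" for i using \<pi> that unfolding bij_betw_def by blast
  have inj: "\<pi> i = \<pi> j \<longleftrightarrow> i = j" if "i < d" "j < d" for i j
    using \<pi> that unfolding bij_betw_def inj_on_def by blast
  have u: "(\<Sum>t<d. cnj (u t i) * u t j) = (if i = j then 1 else 0)" if "i < d" "j < d" for i j
  proof -
    have "(\<Sum>t<d. cnj (u t i) * u t j) = (\<Sum>t<d. if t = \<pi> i then (if i = j then 1 else 0) else 0)"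
      using that by (intro sum.cong) (auto simp: u_def inj)
    thus ?thesis using that lt by simp
  qed
  define F where "F = restrict (\<lambda>k. \<pi> (f k)) {..<n}"
  define H where "H = restrict (\<lambda>k. \<pi> (h k)) {..<n}"
  have F: "F \<in> S" and H: "H \<in> S" unfolding F_def H_def using f h lt by auto
  have 1: "(\<Prod>k<n. u (F k) (g k)) = (if f = g then 1 else 0)" if "g \<in> S" for g
  proof -
    have "(\<Prod>k<n. u (F k) (g k)) = (\<Prod>k<n. if f k = g k then 1 else 0)"
      using f that by (intro prod.cong) (auto simp: u_def F_def inj strsD)
    thus ?thesis unfolding prod_delta_strs[OF f that] by simp
  qed
  have 2: "(\<Prod>k<n. u (g k) (h k)) = (if g = H then 1 else 0)" if "g \<in> S" for g
  proof -
    have "(\<Prod>k<n. u (g k) (h k)) = (\<Prod>k<n. if g k = H k then 1 else 0)"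
      by (intro prod.cong) (auto simp: u_def H_def)
    thus ?thesis unfolding prod_delta_strs[OF that H] by simp
  qed
  have "(\<Sum>g\<in>S. (\<Prod>k<n. u (F k) (g k)) * r g h) = (\<Sum>g\<in>S. if f = g then r f h else 0)"
    by (intro sum.cong) (auto simp: 1)
  moreover have "(\<Sum>g\<in>S. r F g * (\<Prod>k<n. u (g k) (h k))) = (\<Sum>g\<in>S. if H = g then r F H else 0)"
    by (intro sum.cong) (auto simp: 2)
  ultimately have "r f h = r F H" using r_comm[OF u F h] f H by simp
  also have "\<dots> = r (\<lambda>k. \<pi> (f k)) (\<lambda>k. \<pi> (h k))" by (rule r_cong) (auto simp: F_def H_def)
  finally show ?thesis by simp
qed

text \<open>Some permutation of the symbols carries \<open>f\<close> to \<open>h\<close>: it is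
  forced on the range of \<open>f\<close>, and the complements of the two ranges have equal size, so
  it extends.\<close>

lemma r_inj_on_eq:
  assumes f: "f \<in> S" "inj_on f {..<n}" and h: "h \<in> S" "inj_on h {..<n}"
  shows "r f f = r h h"
proof -
  have fs: "f ` {..<n} \<subseteq> {..<d}" and hs: "h ` {..<n} \<subseteq> {..<d}" using f h by auto
  have "card ({..<d} - f ` {..<n}) = card ({..<d} - h ` {..<n})"
    using fs hs by (simp add: card_Diff_subset card_image f h)
  then obtain \<psi> where \<psi>: "bij_betw \<psi> ({..<d} - f ` {..<n}) ({..<d} - h ` {..<n})"
    using finite_same_card_bij by (metis finite_Diff finite_lessThan)
  define \<pi> where "\<pi> i = (if i \<in> f ` {..<n} then h (the_inv_into {..<n} f i) else \<psi> i)" for i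
  have "bij_betw (h \<circ> the_inv_into {..<n} f) (f ` {..<n}) (h ` {..<n})"
    using f(2) h(2) by (intro bij_betw_trans[OF bij_betw_the_inv_into]) (auto simp: bij_betw_def)
  hence "bij_betw \<pi> (f ` {..<n}) (h ` {..<n})"
    by (subst bij_betw_cong[of _ _ "h \<circ> the_inv_into {..<n} f"]) (auto simp: \<pi>_def)
  moreover have "bij_betw \<pi> ({..<d} - f ` {..<n}) ({..<d} - h ` {..<n})"
    using \<psi> by (subst bij_betw_cong[of _ _ \<psi>]) (auto simp: \<pi>_def)
  ultimately have "bij_betw \<pi> (f ` {..<n} \<union> ({..<d} - f ` {..<n})) (h ` {..<n} \<union> ({..<d} - h ` {..<n}))"
    by (rule bij_betw_combine) auto
  moreover have "f ` {..<n} \<union> ({..<d} - f ` {..<n}) = {..<d}" "h ` {..<n} \<union> ({..<d} - h ` {..<n}) = {..<d}"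
    using fs hs by auto
  ultimately have "bij_betw \<pi> {..<d} {..<d}" by simp
  from r_permute[OF this f(1) f(1)] have "r f f = r (\<lambda>k. \<pi> (f k)) (\<lambda>k. \<pi> (f k))" by simp
  also have "\<dots> = r h h"
    by (rule r_cong) (use f(2) in \<open>auto simp: \<pi>_def the_inv_into_f_f\<close>)
  finally show ?thesis .
qed

end

section \<open>Rotations in the plane of two symbols\<close>

text \<open>The angle is complex so that complex derivative rules apply to products of entries;
  unitarity is used at real angles.\<close>

definition rot :: "nat \<Rightarrow> nat \<Rightarrow> complex \<Rightarrow> nat \<Rightarrow> nat \<Rightarrow> complex" where
  "rot a b z i j = (if i = a \<and> j = a \<or> i = b \<and> j = b then cos z
     else if i = b \<and> j = a then sin z else if i = a \<and> j = b then - sin z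
     else if i = j then 1 else 0)"

definition rot_gen :: "nat \<Rightarrow> nat \<Rightarrow> nat \<Rightarrow> nat \<Rightarrow> complex" where
  "rot_gen a b i j = (if i = b \<and> j = a then 1 else if i = a \<and> j = b then - 1 else 0)"

lemma rot_0: "a \<noteq> b \<Longrightarrow> rot a b 0 i j = (if i = j then 1 else 0)"
  by (cases "i = a"; cases "i = b"; cases "j = a"; cases "j = b"; simp add: rot_def)

lemma rot_has_field_derivative:
  assumes "a \<noteq> b"
  shows "((\<lambda>z. rot a b z i j) has_field_derivative rot_gen a b i j) (at 0)"
proof -
  consider "i = a \<and> j = a \<or> i = b \<and> j = b" | "i = b \<and> j = a" | "i = a \<and> j = b" |
    "\<not> (i \<in> {a, b} \<and> j \<in> {a, b})" by blast
  thus ?thesis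
  proof cases
    case 1
    hence "rot_gen a b i j = 0" "(\<lambda>z. rot a b z i j) = cos" using assms by (auto simp: rot_def rot_gen_def)
    thus ?thesis by (auto intro!: derivative_eq_intros)
  next
    case 2
    hence "rot_gen a b i j = 1" "(\<lambda>z. rot a b z i j) = sin" using assms by (auto simp: rot_def rot_gen_def)
    thus ?thesis by (auto intro!: derivative_eq_intros)
  next
    case 3
    hence "rot_gen a b i j = - 1" "(\<lambda>z. rot a b z i j) = (\<lambda>z. - sin z)" using assms by (auto simp: rot_def rot_gen_def)
    thus ?thesis by (auto intro!: derivative_eq_intros)
  next
    case 4
    hence "rot_gen a b i j = 0" "(\<lambda>z. rot a b z i j) = (\<lambda>z. if i = j then 1 else 0)"
      using assms by (auto simp: rot_def rot_gen_def)
    thus ?thesis by simp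
  qed
qed

lemma rot_orthonormal:
  assumes "a \<noteq> b" "a < d" "b < d" "i < d"
  shows "(\<Sum>s<d. cnj (rot a b (of_real t) s i) * rot a b (of_real t) s j) = (if i = j then 1 else 0)"
proof -
  have cc: "complex_of_real (cos t) * of_real (cos t) + of_real (sin t) * of_real (sin t) = 1"
    by (metis of_real_1 of_real_add of_real_mult sin_cos_squared_add3)
  \<comment> \<open>Column \<open>i\<close> of a rotation can be nonzero only in the rows
    \<open>a\<close>, \<open>b\<close> and \<open>i\<close>.\<close>
  have "(\<Sum>s<d. cnj (rot a b (of_real t) s i) * rot a b (of_real t) s j) =
    (\<Sum>s\<in>{a, b, i}. cnj (rot a b (of_real t) s i) * rot a b (of_real t) s j)"
    using assms by (intro sum.mono_neutral_right) (auto simp: rot_def)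
  also have "\<dots> = (if i = j then 1 else 0)"
  proof -
    consider "i = a" | "i = b" | "i \<noteq> a" "i \<noteq> b" by blast
    thus ?thesis
    proof cases
      case 1
      hence "{a, b, i} = {a, b}" by auto
      thus ?thesis using 1 assms(1) cc
        by (cases "j = a"; cases "j = b") (auto simp: rot_def cos_of_real sin_of_real)
    next
      case 2
      hence "{a, b, i} = {a, b}" by auto
      thus ?thesis using 2 assms(1) cc
        by (cases "j = a"; cases "j = b") (auto simp: rot_def cos_of_real sin_of_real add.commute)
    next
      case 3
      thus ?thesis using assms(1) by (auto simp: rot_def)
    qed
  qed
  finally show ?thesis .
qed

text \<open>The indicator factors force \<open>g\<close> to agree with \<open>f\<close> away from
  position \<open>k\<close>. This evaluates the terms of the product rule, in which only one
  position carries the generator.\<close>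

lemma sum_strs_single_site:
  fixes G :: "(nat \<Rightarrow> nat) \<Rightarrow> 'a :: comm_semiring_1"
  assumes f: "f \<in> strs n d" and k: "k < n"
  shows "(\<Sum>g\<in>strs n d. c (g k) * (\<Prod>l\<in>{..<n} - {k}. if f l = g l then 1 else 0) * G g) =
    (\<Sum>t<d. c t * G (f(k := t)))"
proof -
  have inj: "inj_on (\<lambda>t. f(k := t)) {..<d}" by (intro inj_onI) (metis fun_upd_same)
  have "(\<Sum>g\<in>strs n d. c (g k) * (\<Prod>l\<in>{..<n} - {k}. if f l = g l then 1 else 0) * G g) =
    (\<Sum>g\<in>(\<lambda>t. f(k := t)) ` {..<d}. c (g k) * (\<Prod>l\<in>{..<n} - {k}. if f l = g l then 1 else 0) * G g)"
  proof (rule sum.mono_neutral_right)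
    show "(\<lambda>t. f(k := t)) ` {..<d} \<subseteq> strs n d" using strs_fun_upd[OF f k] by blast
    show "\<forall>g\<in>strs n d - (\<lambda>t. f(k := t)) ` {..<d}.
      c (g k) * (\<Prod>l\<in>{..<n} - {k}. if f l = g l then 1 else 0) * G g = 0"
    proof
      fix g assume g: "g \<in> strs n d - (\<lambda>t. f(k := t)) ` {..<d}"
      have "\<exists>l\<in>{..<n} - {k}. f l \<noteq> g l"
      proof (rule ccontr)
        assume "\<not> ?thesis"
        hence same: "f l = g l" if "l < n" "l \<noteq> k" for l using that by blast
        have gk: "g k < d" using g k by (intro strsD[of g n d]) auto
        have "g = f(k := g k)"
          by (rule PiE_ext[OF _ strs_fun_upd[OF f k gk]]) (use g same in auto)
        thus False using g gk by blast
      qed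
      hence "(\<Prod>l\<in>{..<n} - {k}. if f l = g l then 1 else 0 :: 'a) = 0"
        by (intro prod_zero) auto
      thus "c (g k) * (\<Prod>l\<in>{..<n} - {k}. if f l = g l then 1 else 0) * G g = 0" by simp
    qed
  qed simp
  also have "\<dots> = (\<Sum>t<d. c t * G (f(k := t)))"
    by (subst sum.reindex[OF inj]) (auto intro!: sum.cong)
  finally show ?thesis .
qed

context werner
begin

text \<open>The derivative at \<open>0\<close> of the commutation relation with the rotations in the plane of
  the symbols \<open>a\<close> and \<open>b\<close>.\<close>
lemma r_rotation:
  assumes ab: "a \<noteq> b" "a < d" "b < d" and f: "f \<in> S" and h: "h \<in> S"
  shows "(\<Sum>k<n. if f k = b then r (f(k := a)) h else if f k = a then - r (f(k := b)) h else 0) =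
    (\<Sum>k<n. if h k = a then r f (h(k := b)) else if h k = b then - r f (h(k := a)) else 0)"
proof -
  \<comment> \<open>\<open>F\<close> is the difference of the two sides of the commutation relation;
    \<open>L\<close> below is the derivative at 0 of an entry of the tensor power, by the product
    rule.\<close>
  define F where "F z = (\<Sum>g\<in>S. (\<Prod>k<n. rot a b z (f k) (g k)) * r g h) -
    (\<Sum>g\<in>S. r f g * (\<Prod>k<n. rot a b z (g k) (h k)))" for z
  define L where "L f g = (\<Sum>k<n. rot_gen a b (f k) (g k) * (\<Prod>l\<in>{..<n} - {k}. rot a b 0 (f l) (g l)))"
    for f g
  have dprod: "((\<lambda>z. \<Prod>k<n. rot a b z (f k) (g k)) has_field_derivative L f g) (at 0)" for f g
    unfolding L_def by (rule has_field_derivative_prod) (rule rot_has_field_derivative[OF ab(1)])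
  have dF: "(F has_field_derivative (\<Sum>g\<in>S. L f g * r g h) - (\<Sum>g\<in>S. r f g * L g h)) (at 0)"
    unfolding F_def by (intro DERIV_diff DERIV_sum DERIV_cmult DERIV_cmult_right dprod)
  have F0: "F (of_real t) = 0" for t
    unfolding F_def using r_comm[OF rot_orthonormal[OF ab] f h, of t] by simp
  have "(\<Sum>g\<in>S. L f g * r g h) - (\<Sum>g\<in>S. r f g * L g h) = 0"
  proof -
    \<comment> \<open>\<open>F\<close> is known to vanish at real angles, so its complex derivative
      at 0 is computed along the real sequence \<open>1 / Suc m\<close>, where all difference
      quotients are 0.\<close>
    have lim: "(\<lambda>m. (F (of_real (1 / Suc m)) - F 0) / of_real (1 / Suc m)) \<longlonglongrightarrow>
      (\<Sum>g\<in>S. L f g * r g h) - (\<Sum>g\<in>S. r f g * L g h)"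
    proof (rule filterlim_compose[where g = "\<lambda>h. (F h - F 0) / h"])
      show "((\<lambda>h. (F h - F 0) / h) \<longlongrightarrow> (\<Sum>g\<in>S. L f g * r g h) - (\<Sum>g\<in>S. r f g * L g h)) (at 0)"
        using dF by (simp add: DERIV_def)
      have "(\<lambda>m. complex_of_real (1 / Suc m)) \<longlonglongrightarrow> of_real 0"
        by (intro tendsto_of_real LIMSEQ_Suc[OF lim_1_over_n])
      thus "filterlim (\<lambda>m. complex_of_real (1 / Suc m)) (at 0) sequentially"
        unfolding filterlim_at by (simp del: of_real_divide of_nat_Suc)
    qed
    have zero: "(\<lambda>m. (F (of_real (1 / Suc m)) - F 0) / of_real (1 / Suc m)) = (\<lambda>m. 0)"
      using F0 F0[of 0] by (intro ext) (simp del: of_real_divide)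
    show ?thesis by (rule LIMSEQ_unique[OF lim[unfolded zero] tendsto_const])
  qed
  moreover have "(\<Sum>g\<in>S. L f g * r g h) =
    (\<Sum>k<n. if f k = b then r (f(k := a)) h else if f k = a then - r (f(k := b)) h else 0)"
  proof -
    have "(\<Sum>g\<in>S. L f g * r g h) = (\<Sum>k<n. \<Sum>g\<in>S. rot_gen a b (f k) (g k) *
        (\<Prod>l\<in>{..<n} - {k}. if f l = g l then 1 else 0) * r g h)"
      unfolding L_def rot_0[OF ab(1)] sum_distrib_right by (rule sum.swap)
    also have "\<dots> = (\<Sum>k<n. \<Sum>t<d. rot_gen a b (f k) t * r (f(k := t)) h)"
      by (intro sum.cong refl sum_strs_single_site[OF f]) simp
    also have "\<dots> = (\<Sum>k<n. if f k = b then r (f(k := a)) h else if f k = a then - r (f(k := b)) h else 0)"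
    proof (intro sum.cong refl)
      fix k
      have "(\<Sum>t<d. rot_gen a b (f k) t * r (f(k := t)) h) =
        (\<Sum>t\<in>{a, b}. rot_gen a b (f k) t * r (f(k := t)) h)"
        using ab by (intro sum.mono_neutral_right) (auto simp: rot_gen_def)
      thus "(\<Sum>t<d. rot_gen a b (f k) t * r (f(k := t)) h) =
        (if f k = b then r (f(k := a)) h else if f k = a then - r (f(k := b)) h else 0)"
        using ab(1) by (cases "f k = a"; cases "f k = b") (simp_all add: rot_gen_def)
    qed
    finally show ?thesis .
  qed
  moreover have "(\<Sum>g\<in>S. r f g * L g h) =
    (\<Sum>k<n. if h k = a then r f (h(k := b)) else if h k = b then - r f (h(k := a)) else 0)"
  proof -
    have sym: "(\<Prod>l\<in>A. if g l = h l then 1 else 0 :: complex) = (\<Prod>l\<in>A. if h l = g l then 1 else 0)" for A g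
      by (intro prod.cong) auto
    have "(\<Sum>g\<in>S. r f g * L g h) = (\<Sum>g\<in>S. \<Sum>k<n. rot_gen a b (g k) (h k) *
        (\<Prod>l\<in>{..<n} - {k}. if h l = g l then 1 else 0) * r f g)"
      unfolding L_def rot_0[OF ab(1)] sum_distrib_left sym by (simp only: mult_ac)
    also have "\<dots> = (\<Sum>k<n. \<Sum>g\<in>S. rot_gen a b (g k) (h k) *
        (\<Prod>l\<in>{..<n} - {k}. if h l = g l then 1 else 0) * r f g)" by (rule sum.swap)
    also have "\<dots> = (\<Sum>k<n. \<Sum>t<d. rot_gen a b t (h k) * r f (h(k := t)))"
      by (intro sum.cong refl sum_strs_single_site[OF h, where c = "\<lambda>t. rot_gen a b t (h _)"]) simp
    also have "\<dots> = (\<Sum>k<n. if h k = a then r f (h(k := b)) else if h k = b then - r f (h(k := a)) else 0)"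
    proof (intro sum.cong refl)
      fix k
      have "(\<Sum>t<d. rot_gen a b t (h k) * r f (h(k := t))) =
        (\<Sum>t\<in>{a, b}. rot_gen a b t (h k) * r f (h(k := t)))"
        using ab by (intro sum.mono_neutral_right) (auto simp: rot_gen_def)
      thus "(\<Sum>t<d. rot_gen a b t (h k) * r f (h(k := t))) =
        (if h k = a then r f (h(k := b)) else if h k = b then - r f (h(k := a)) else 0)"
        using ab(1) by (cases "h k = a"; cases "h k = b") (simp_all add: rot_gen_def)
    qed
    finally show ?thesis .
  qed
  ultimately show ?thesis by simp
qed

section \<open>Comparison of the diagonal entries\<close>

text \<open>The rotation identity at \<open>h(j := b)\<close> and \<open>h\<close> writes
  \<open>r h h\<close> as a row sum of the block of \<rho> on the strings \<open>h(k := b)\<close>.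
  Averaging over the rows \<open>j\<close> and bounding each entry by the mean of two diagonal
  entries leaves the sum of the diagonal.\<close>

lemma r_diag_le_sum_fun_upd:
  assumes ab: "a \<noteq> b" "a < d" "b < d" and h: "h \<in> S" and b0: "cnt n h b = 0" and a0: "0 < cnt n h a"
  shows "Re (r h h) \<le> (\<Sum>k | k < n \<and> h k = a. Re (r (h(k := b)) (h(k := b))))"
proof -
  define K where "K = {k. k < n \<and> h k = a}"
  have finK [simp]: "finite K" unfolding K_def by simp
  have cardK: "card K = cnt n h a" unfolding K_def cnt_def by simp
  have nb: "h k \<noteq> b" if "k < n" for k using b0 cnt_pos[OF that, of h] by auto
  have hk: "h(k := b) \<in> S" if "k \<in> K" for k using that h ab strs_fun_upd by (auto simp: K_def)
  have eq: "r h h = (\<Sum>k\<in>K. r (h(j := b)) (h(k := b)))" if j: "j \<in> K" for j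
  proof -
    have jn: "j < n" "h j = a" using j by (auto simp: K_def)
    let ?f = "h(j := b)"
    \<comment> \<open>The left string contains \<open>b\<close> and \<open>h\<close> does not, so
      their multiplicities differ and the entry vanishes.\<close>
    have z: "r (?f(k := b)) h = 0" if "k < n" "?f k = a" for k
    proof (rule ccontr)
      assume nz: "r (?f(k := b)) h \<noteq> 0"
      have "cnt n (?f(k := b)) b = cnt n h b"
        by (rule r_weight[OF _ h nz]) (use strs_fun_upd[OF hk[OF j]] that ab in auto)
      moreover have "0 < cnt n (?f(k := b)) b" using cnt_pos[of k n "?f(k := b)"] that by simp
      ultimately show False using b0 by simp
    qed
    have "(\<Sum>k<n. if ?f k = b then r (?f(k := a)) h else if ?f k = a then - r (?f(k := b)) h else 0) =
      (\<Sum>k<n. if k = j then r h h else 0)"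
    proof (intro sum.cong refl)
      fix k assume "k \<in> {..<n}"
      hence k: "k < n" by simp
      have "?f(j := a) = h" using jn by auto
      thus "(if ?f k = b then r (?f(k := a)) h else if ?f k = a then - r (?f(k := b)) h else 0) =
        (if k = j then r h h else 0)"
        using z[OF k] nb[OF k] by (auto simp del: fun_upd_upd)
    qed
    also have "\<dots> = r h h" using jn by simp
    finally have "r h h = (\<Sum>k<n. if h k = a then r ?f (h(k := b)) else if h k = b then - r ?f (h(k := a)) else 0)"
      using r_rotation[OF ab hk[OF j] h] by simp
    also have "\<dots> = (\<Sum>k<n. if h k = a then r ?f (h(k := b)) else 0)"
      using nb by (intro sum.cong) auto
    also have "\<dots> = (\<Sum>k\<in>K. r ?f (h(k := b)))"
      unfolding K_def by (simp add: sum.inter_filter[symmetric] lessThan_def)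
    finally show ?thesis .
  qed
  let ?s = "\<lambda>k. Re (r (h(k := b)) (h(k := b)))"
  have "real (card K) * Re (r h h) = (\<Sum>j\<in>K. Re (r h h))" by simp
  also have "\<dots> = (\<Sum>j\<in>K. \<Sum>k\<in>K. Re (r (h(j := b)) (h(k := b))))"
    by (intro sum.cong refl) (metis (no_types, lifting) Re_sum eq sum.cong)
  also have "\<dots> \<le> (\<Sum>j\<in>K. \<Sum>k\<in>K. (?s j + ?s k) / 2)"
    by (intro sum_mono r_offdiag_le hk)
  also have "\<dots> = real (card K) * (\<Sum>k\<in>K. ?s k)"
    by (simp add: add_divide_distrib sum.distrib sum_divide_distrib[symmetric] flip: sum_distrib_left)
  finally show ?thesis using a0 cardK unfolding K_def[symmetric] by simp
qed

text \<open>Induction on the number of symbols missing for injectivity. Turning one copy of a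
  repeated symbol \<open>a\<close> into a fresh \<open>b\<close> adds a symbol and divides
  \<open>cnt_fact\<close> by \<open>cnt n h a\<close>, which is exactly the number of terms in
  \<open>r_diag_le_sum_fun_upd\<close>.\<close>

lemma r_diag_le_cnt_fact:
  assumes nd: "n \<le> d" and h: "h \<in> S"
    and e: "e \<in> S" "inj_on e {..<n}"
  shows "Re (r h h) \<le> real (cnt_fact n d h) * Re (r e e)"
  using h
proof (induction "n - card (h ` {..<n})" arbitrary: h rule: less_induct)
  case less
  show ?case
  proof (cases "inj_on h {..<n}")
    case True
    have "Re (r h h) = Re (r e e)" using r_inj_on_eq[OF less.prems True e] by simp
    also have "\<dots> \<le> real (cnt_fact n d h) * Re (r e e)"
      using cnt_fact_pos[of n d h] r_diag_nonneg(1)[OF e(1)]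
      by (simp add: mult_le_cancel_right1)
    finally show ?thesis .
  next
    case False
    then obtain i j where ij: "i < n" "j < n" "i \<noteq> j" "h i = h j" unfolding inj_on_def by auto
    have sub: "h ` {..<n} \<subseteq> {..<d}" using less.prems by auto
    have lt: "card (h ` {..<n}) < n"
      using False card_image_le[of "{..<n}" h] eq_card_imp_inj_on[of "{..<n}" h] by fastforce
    \<comment> \<open>A repetition leaves fewer than \<open>n \<le> d\<close> symbols in use, so a
      fresh one exists.\<close>
    hence "h ` {..<n} \<noteq> {..<d}" using nd by auto
    then obtain b where b: "b < d" "b \<notin> h ` {..<n}" using sub by auto
    define a where "a = h i"
    have a: "a < d" "a \<noteq> b" using less.prems ij b unfolding a_def by (auto simp: strsD)
    have b0: "cnt n h b = 0" using b unfolding cnt_def by auto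
    have a0: "0 < cnt n h a" unfolding a_def by (rule cnt_pos[OF ij(1)])
    have step: "Re (r (h(k := b)) (h(k := b))) \<le> real (cnt_fact n d h) / real (cnt n h a) * Re (r e e)"
      if k: "k < n" "h k = a" for k
    proof -
      have hk: "h(k := b) \<in> S" using less.prems k b by (intro strs_fun_upd)
      have "h(k := b) ` {..<n} = insert b (h ` {..<n})"
      proof
        show "h(k := b) ` {..<n} \<subseteq> insert b (h ` {..<n})" by auto
        have "h l \<in> h(k := b) ` {..<n}" if "l < n" for l
        proof (cases "l = k")
          case True
          \<comment> \<open>\<open>m\<close> is a second position carrying \<open>a\<close>, so
            \<open>a\<close> still occurs after position \<open>k\<close> is overwritten.\<close>
          define m where "m = (if k = i then j else i)"
          have "m < n" "m \<noteq> k" "h m = h l" using ij k True unfolding m_def a_def by auto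
          thus ?thesis by (intro image_eqI[of _ _ m]) auto
        next
          case False
          thus ?thesis using that by (intro image_eqI[of _ _ l]) auto
        qed
        moreover have "b \<in> h(k := b) ` {..<n}" using k by (intro image_eqI[of _ _ k]) auto
        ultimately show "insert b (h ` {..<n}) \<subseteq> h(k := b) ` {..<n}" by auto
      qed
      hence "n - card (h(k := b) ` {..<n}) < n - card (h ` {..<n})"
        using b(2) lt by simp
      hence "Re (r (h(k := b)) (h(k := b))) \<le> real (cnt_fact n d (h(k := b))) * Re (r e e)"
        using less.hyps hk by blast
      also have "real (cnt_fact n d (h(k := b))) = real (cnt_fact n d h) / real (cnt n h a)"
        using cnt_fact_fun_upd[OF k(1,2) a(1) a(2)[symmetric] b(1) b0] a0 by (simp add: field_simps flip: of_nat_mult)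
      finally show ?thesis .
    qed
    have "Re (r h h) \<le> (\<Sum>k | k < n \<and> h k = a. Re (r (h(k := b)) (h(k := b))))"
      by (rule r_diag_le_sum_fun_upd[OF a(2,1) b(1) less.prems b0 a0])
    also have "\<dots> \<le> (\<Sum>k | k < n \<and> h k = a. real (cnt_fact n d h) / real (cnt n h a) * Re (r e e))"
      by (rule sum_mono) (use step in auto)
    also have "\<dots> = real (cnt_fact n d h) * Re (r e e)"
      using a0 unfolding sum_constant cnt_def[symmetric] by simp
    finally show ?thesis .
  qed
qed

text \<open>The bounds on all diagonal entries are summed: the left sides add up to the trace 1, the
  coefficients on the right to the rising factorial of \<open>d\<close>.\<close>

lemma r_injective_diag_ge:
  assumes nd: "n \<le> d" and e: "e \<in> S" "inj_on e {..<n}"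
  shows "1 \<le> (\<Prod>i<n. real (d + i)) * Re (r e e)"
proof -
  have "1 = (\<Sum>f\<in>S. Re (r f f))" using arg_cong[OF r_trace, of Re] by simp
  also have "\<dots> \<le> (\<Sum>f\<in>S. real (cnt_fact n d f) * Re (r e e))"
    by (intro sum_mono r_diag_le_cnt_fact[OF nd _ e])
  also have "\<dots> = real (\<Sum>f\<in>S. cnt_fact n d f) * Re (r e e)" by (simp add: sum_distrib_right)
  finally show ?thesis unfolding sum_cnt_fact by simp
qed

end

section \<open>The partial trace\<close>

definition pair_str :: "nat \<Rightarrow> nat \<Rightarrow> (nat \<Rightarrow> nat) \<Rightarrow> (nat \<Rightarrow> nat) \<Rightarrow> nat \<Rightarrow> nat" where
  "pair_str q n a c = restrict (\<lambda>k. a k * q + c k) {..<n}"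

lemma pair_less: "(x :: nat) < p \<Longrightarrow> y < q \<Longrightarrow> x * q + y < p * q"
proof -
  assume "x < p" "y < q"
  hence "x * q + y < Suc x * q" by simp
  also have "\<dots> \<le> p * q" using \<open>x < p\<close> by (intro mult_right_mono) auto
  finally show ?thesis .
qed

lemma pair_str_in_strs:
  assumes "a \<in> strs n p" "c \<in> strs n q"
  shows "pair_str q n a c \<in> strs n (p * q)"
  using assms by (auto simp: pair_str_def strsD intro!: pair_less)

lemma pair_eq_iff:
  fixes x y q :: nat
  assumes "y < q" "y' < q"
  shows "x * q + y = x' * q + y' \<longleftrightarrow> x = x' \<and> y = y'"
proof
  assume eq: "x * q + y = x' * q + y'"
  have "(x * q + y) div q = x" "(x' * q + y') div q = x'" using assms by simp_all
  hence "x = x'" using eq by simp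
  thus "x = x' \<and> y = y'" using eq by simp
qed simp

lemma bij_betw_pair_str:
  "bij_betw (\<lambda>(a, c). pair_str q n a c) (strs n p \<times> strs n q) (strs n (p * q))"
proof -
  have inj: "inj_on (\<lambda>(a, c). pair_str q n a c) (strs n p \<times> strs n q)"
  proof (rule inj_onI, clarify)
    fix a c a' c' assume m: "a \<in> strs n p" "c \<in> strs n q" "a' \<in> strs n p" "c' \<in> strs n q"
      and eq: "pair_str q n a c = pair_str q n a' c'"
    have "a k = a' k \<and> c k = c' k" if "k < n" for k
      using fun_cong[OF eq, of k] that strsD[OF m(2) that] strsD[OF m(4) that]
      by (simp add: pair_str_def pair_eq_iff)
    thus "a = a' \<and> c = c'" using PiE_ext[OF m(1,3)] PiE_ext[OF m(2,4)] by auto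
  qed
  moreover have "(\<lambda>(a, c). pair_str q n a c) ` (strs n p \<times> strs n q) = strs n (p * q)"
  proof (rule card_subset_eq)
    show "(\<lambda>(a, c). pair_str q n a c) ` (strs n p \<times> strs n q) \<subseteq> strs n (p * q)"
      by (rule image_subsetI) (simp add: case_prod_unfold mem_Times_iff pair_str_in_strs)
    show "card ((\<lambda>(a, c). pair_str q n a c) ` (strs n p \<times> strs n q)) = card (strs n (p * q))"
      unfolding card_image[OF inj] by (simp add: card_funcsetE card_cartesian_product power_mult_distrib)
  qed simp
  ultimately show ?thesis unfolding bij_betw_def by simp
qed

lemma pq_index_enc:
  assumes a: "a \<in> strs n p" and c: "c \<in> strs n q"
  shows "pq_index p q n (enc p n a) (enc q n c) = enc (p * q) n (pair_str q n a c)"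
proof -
  have "enc p n a div p ^ k mod p = a k" "enc q n c div q ^ k mod q = c k" if "k < n" for k
    using a c that by (auto intro!: enc_digit simp: strsD)
  thus ?thesis unfolding pq_index_def enc_def[of "p * q"] pair_str_def by (intro sum.cong) auto
qed

lemma inj_on_pair_str:
  assumes "c \<in> strs n q" "inj_on c {..<n}"
  shows "inj_on (pair_str q n a c) {..<n}"
proof (rule inj_onI)
  fix k l assume kl: "k \<in> {..<n}" "l \<in> {..<n}" and "pair_str q n a c k = pair_str q n a c l"
  hence "c k = c l" using strsD[OF assms(1), of k] strsD[OF assms(1), of l]
    by (simp add: pair_str_def pair_eq_iff)
  thus "k = l" by (rule inj_onD[OF assms(2) _ kl])
qed

lemma card_inj_strs: "card {c \<in> strs n q. inj_on c {..<n}} = (\<Prod>i<n. q - i)"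
  using card_inj_on_subset_funcset[of "{..<n}" "{..<q}" "{..<n}"] by (simp add: atLeast0LessThan)

text \<open>Equal multiplicities place the symbol \<open>(a k, c k)\<close> of the first string at
  some position \<open>l\<close> of the second. Then \<open>c l = c k\<close>, injectivity gives
  \<open>l = k\<close>, and so \<open>a k = b k\<close>.\<close>

lemma (in werner) r_pair_inj:
  assumes d: "d = p * q" and c: "c \<in> strs n q" "inj_on c {..<n}"
    and a: "a \<in> strs n p" and b: "b \<in> strs n p" and nz: "r (pair_str q n a c) (pair_str q n b c) \<noteq> 0"
  shows "a = b"
proof (rule PiE_ext[OF a b])
  fix k assume "k \<in> {..<n}"
  hence k: "k < n" by simp
  have pa: "pair_str q n a c \<in> S" and pb: "pair_str q n b c \<in> S"
    unfolding d using a b c by (auto intro!: pair_str_in_strs)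
  have "0 < cnt n (pair_str q n b c) (pair_str q n a c k)"
    using r_weight[OF pa pb nz] cnt_pos[OF k] by metis
  then obtain l where l: "l < n" "pair_str q n b c l = pair_str q n a c k"
    unfolding cnt_def card_gt_0_iff by auto
  hence "b l = a k \<and> c l = c k"
    using k strsD[OF c(1) k] strsD[OF c(1) l(1)] by (simp add: pair_str_def pair_eq_iff)
  moreover from this have "l = k" using c(2) k l(1) by (auto dest: inj_onD)
  ultimately show "a k = b k" by simp
qed

theorem ptrace_werner_trace_norm_le:
  assumes p: "0 < p" and n: "0 < n" and nq: "n \<le> q" and W: "werner_state (p * q) n \<rho>"
  shows "trace_norm (ptrace_q p q n \<rho> - (1 / of_nat (p ^ n)) \<cdot>\<^sub>m 1\<^sub>m (p ^ n))
           \<le> 2 - 2 * ((real q - real n + 1) / real q) ^ n"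
proof -
  interpret werner "p * q" n \<rho> by (unfold_locales) (rule W)
  define D where "D = p ^ n"
  have Dpos: "D > 0" unfolding D_def using p by simp
  define \<delta> where "\<delta> = the_inv_into (strs n p) (enc p n)"
  have \<delta>: "\<delta> i \<in> strs n p" "enc p n (\<delta> i) = i" if "i < D" for i
  proof -
    have i: "i \<in> enc p n ` strs n p"
      unfolding bij_betw_imp_surj_on[OF bij_betw_enc] using that by (simp add: D_def)
    show "\<delta> i \<in> strs n p" "enc p n (\<delta> i) = i" unfolding \<delta>_def
      using the_inv_into_into[OF bij_betw_imp_inj_on[OF bij_betw_enc] i subset_refl]
        f_the_inv_into_f[OF bij_betw_imp_inj_on[OF bij_betw_enc] i] .
  qed
  have \<delta>_inj: "\<delta> i = \<delta> j \<longleftrightarrow> i = j" if "i < D" "j < D" for i j using \<delta> that by metis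
  define P where "P i c = pair_str q n (\<delta> i) c" for i c
  have P: "P i c \<in> S" if "i < D" "c \<in> strs n q" for i c
    unfolding P_def using \<delta> that by (intro pair_str_in_strs)
  define J where "J = {c \<in> strs n q. inj_on c {..<n}}"
  have J: "J \<subseteq> strs n q" unfolding J_def by auto
  \<comment> \<open>The string 0, 1, ..., \<open>n - 1\<close> serves as the injective reference
    string; it exists because \<open>n \<le> p * q\<close>.\<close>
  define e where "e = restrict (\<lambda>k. k) {..<n}"
  have nd: "n \<le> p * q" using nq p by (simp add: le_trans[OF nq])
  have e: "e \<in> S" "inj_on e {..<n}" using nd unfolding e_def by (auto simp: inj_on_def)
  define t where "t = Re (r e e)"
  have ree: "r e e = of_real t" unfolding t_def using r_diag_nonneg(2)[OF e(1)] by (simp add: complex_eq_iff)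
  define N where "N = real (\<Prod>i<n. q - i)"
  define M where "M = ptrace_q p q n \<rho>"
  \<comment> \<open>\<open>R\<close> collects the contributions of the non-injective
    \<open>c\<close>.\<close>
  define R where "R = mat D D (\<lambda>(i, j). \<Sum>c\<in>strs n q - J. r (P i c) (P j c))"
  have R: "R \<in> carrier_mat D D" unfolding R_def by simp
  have M: "M \<in> carrier_mat D D" unfolding M_def ptrace_q_def D_def by simp
  have Mij: "M $$ (i, j) = (\<Sum>c\<in>strs n q. r (P i c) (P j c))" if ij: "i < D" "j < D" for i j
  proof -
    have "M $$ (i, j) = (\<Sum>c\<in>strs n q. \<rho> $$ (pq_index p q n i (enc q n c), pq_index p q n j (enc q n c)))"
      using ij unfolding M_def ptrace_q_def D_def by (simp add: sum_enc)
    also have "\<dots> = (\<Sum>c\<in>strs n q. r (P i c) (P j c))"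
    proof (intro sum.cong refl)
      fix c assume "c \<in> strs n q"
      hence "pq_index p q n i (enc q n c) = enc (p * q) n (P i c)" "pq_index p q n j (enc q n c) = enc (p * q) n (P j c)"
        using pq_index_enc[OF \<delta>(1)[OF ij(1)]] pq_index_enc[OF \<delta>(1)[OF ij(2)]] \<delta>(2) ij unfolding P_def by auto
      thus "\<rho> $$ (pq_index p q n i (enc q n c), pq_index p q n j (enc q n c)) = r (P i c) (P j c)"
        unfolding r_def by simp
    qed
    finally show ?thesis .
  qed
  have MR: "M $$ (i, j) = R $$ (i, j) + (if i = j then of_real (N * t) else 0)" if ij: "i < D" "j < D" for i j
  proof -
    \<comment> \<open>An injective \<open>c\<close> makes every \<open>P i c\<close> injective, so
      the diagonal entries are all \<open>t\<close>; the others vanish by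
      \<open>r_pair_inj\<close>.\<close>
    have "r (P i c) (P j c) = (if i = j then of_real t else 0)" if c: "c \<in> J" for c
    proof (cases "i = j")
      case True
      have "P i c \<in> S" "inj_on (P i c) {..<n}" using c P[OF ij(1)] inj_on_pair_str unfolding J_def P_def by auto
      thus ?thesis using True r_inj_on_eq[OF _ _ e] ree by simp
    next
      case False
      thus ?thesis using r_pair_inj[OF refl _ _ \<delta>(1)[OF ij(1)] \<delta>(1)[OF ij(2)], of c] c \<delta>_inj[OF ij]
        unfolding J_def P_def by auto
    qed
    hence "(\<Sum>c\<in>J. r (P i c) (P j c)) = of_nat (card J) * (if i = j then of_real t else 0)" by simp
    moreover have "of_nat (card J) = complex_of_real N" unfolding N_def J_def card_inj_strs of_real_of_nat_eq ..
    moreover have "M $$ (i, j) = (\<Sum>c\<in>strs n q - J. r (P i c) (P j c)) + (\<Sum>c\<in>J. r (P i c) (P j c))"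
      unfolding Mij[OF ij] by (rule sum.subset_diff[OF J finite_strs])
    moreover have "R $$ (i, j) = (\<Sum>c\<in>strs n q - J. r (P i c) (P j c))" using ij by (simp add: R_def)
    ultimately show ?thesis by simp
  qed
  have Rpsd: "psd_mat D R"
  proof -
    have Rh: "mat_adjoint R = R"
    proof (rule eq_matI)
      fix i j assume "i < dim_row R" "j < dim_col R"
      hence ij: "i < D" "j < D" using R by auto
      have "(\<Sum>c\<in>strs n q - J. cnj (r (P j c) (P i c))) = (\<Sum>c\<in>strs n q - J. r (P i c) (P j c))"
        by (intro sum.cong refl r_hermitian[symmetric] P ij) auto
      thus "mat_adjoint R $$ (i, j) = R $$ (i, j)" using ij R by (simp add: R_def)
    qed (use R in auto)
    have "Im (\<Sum>i<D. cnj (v $ i) * (R *\<^sub>v v) $ i) = 0 \<and> 0 \<le> Re (\<Sum>i<D. cnj (v $ i) * (R *\<^sub>v v) $ i)"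
      if v: "v \<in> carrier_vec D" for v
    proof -
      have "(\<Sum>i<D. cnj (v $ i) * (R *\<^sub>v v) $ i) =
        (\<Sum>i<D. \<Sum>j<D. \<Sum>c\<in>strs n q - J. cnj (v $ i) * r (P i c) (P j c) * v $ j)"
        unfolding quadratic_form_sum[OF R v] by (intro sum.cong refl) (simp add: R_def sum_distrib_left sum_distrib_right)
      also have "\<dots> = (\<Sum>c\<in>strs n q - J. \<Sum>i<D. \<Sum>j<D. cnj (v $ i) * r (P i c) (P j c) * v $ j)"
        by (rule trans[OF sum.cong[OF refl sum.swap] sum.swap])
      finally have eq: "(\<Sum>i<D. cnj (v $ i) * (R *\<^sub>v v) $ i) =
        (\<Sum>c\<in>strs n q - J. \<Sum>i<D. \<Sum>j<D. cnj (v $ i) * r (P i c) (P j c) * v $ j)" .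
      \<comment> \<open>For fixed \<open>c\<close> the double sum is the quadratic form of \<rho> on
        the family of strings \<open>P i c\<close>.\<close>
      have c: "Im (\<Sum>i<D. \<Sum>j<D. cnj (v $ i) * r (P i c) (P j c) * v $ j) = 0"
        "0 \<le> Re (\<Sum>i<D. \<Sum>j<D. cnj (v $ i) * r (P i c) (P j c) * v $ j)" if c: "c \<in> strs n q - J" for c
        by (intro r_psd[of "{..<D}" "\<lambda>i. P i c" "\<lambda>i. v $ i"] finite_lessThan P; use c in simp)+
      show ?thesis unfolding eq Im_sum[of _ "strs n q - J"] Re_sum[of _ "strs n q - J"]
        by (intro conjI sum.neutral ballI sum_nonneg c)
    qed
    thus ?thesis unfolding psd_mat_def using R Rh by blast
  qed
  \<comment> \<open>\<open>\<beta>\<close> is what the scalar part \<open>N * t\<close> of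
    \<open>M\<close> lacks to \<open>1 / D\<close>. As \<open>M\<close> has trace 1, the trace of
    \<open>R\<close> is \<open>D * \<beta>\<close>, so the norm bound is twice this trace.\<close>
  define \<beta> where "\<beta> = 1 / real D - N * t"
  have trR: "mat_trace R = of_real (real D * \<beta>)"
  proof -
    have "(\<Sum>i<D. M $$ (i, i)) = (\<Sum>a\<in>strs n p. \<Sum>c\<in>strs n q. r (P (enc p n a) c) (P (enc p n a) c))"
      unfolding D_def sum_enc by (intro sum.cong refl Mij) (simp_all add: D_def enc_strs_less)
    also have "\<dots> = (\<Sum>a\<in>strs n p. \<Sum>c\<in>strs n q. r (pair_str q n a c) (pair_str q n a c))"
      unfolding P_def \<delta>_def
      by (intro sum.cong refl) (simp add: the_inv_into_f_f[OF bij_betw_imp_inj_on[OF bij_betw_enc]])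
    also have "\<dots> = (\<Sum>f\<in>S. r f f)"
      unfolding sum.cartesian_product using sum.reindex_bij_betw[OF bij_betw_pair_str, of "\<lambda>f. r f f" q n p]
      by (simp add: case_prod_unfold)
    finally have "(\<Sum>i<D. M $$ (i, i)) = 1" using r_trace by simp
    moreover have "(\<Sum>i<D. M $$ (i, i)) = mat_trace R + of_nat D * of_real (N * t)"
      unfolding mat_trace_def using R by (simp add: MR sum.distrib)
    ultimately have "mat_trace R = 1 - of_nat D * of_real (N * t)" by (simp add: algebra_simps)
    also have "\<dots> = of_real (real D * \<beta>)" unfolding \<beta>_def using Dpos by (simp add: algebra_simps)
    finally show ?thesis .
  qed
  have "0 \<le> Re (mat_trace R)"
  proof -
    have "mat_trace R = (\<Sum>i<D. \<Sum>c\<in>strs n q - J. r (P i c) (P i c))"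
      unfolding mat_trace_def R_def by simp
    hence "Re (mat_trace R) = (\<Sum>i<D. \<Sum>c\<in>strs n q - J. Re (r (P i c) (P i c)))" by (simp only: Re_sum)
    thus ?thesis by (simp only:) (intro sum_nonneg r_diag_nonneg(1) P; simp)
  qed
  hence \<beta>0: "\<beta> \<ge> 0" using trR Dpos by (simp add: zero_le_mult_iff)
  have X: "M - (1 / of_nat D) \<cdot>\<^sub>m 1\<^sub>m D = R - of_real \<beta> \<cdot>\<^sub>m 1\<^sub>m D"
    using M R by (intro eq_matI) (auto simp: MR \<beta>_def)
  have "trace_norm (M - (1 / of_nat D) \<cdot>\<^sub>m 1\<^sub>m D) \<le> Re (mat_trace R) + \<beta> * real D"
    unfolding X by (rule trace_norm_psd_minus_scalar_le[OF Rpsd \<beta>0])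
  \<comment> \<open>The product \<open>D * N * t\<close> is the weight \<alpha> of the injective
    strings.\<close>
  also have "\<dots> = 2 - 2 * (real D * N * t)"
    unfolding trR \<beta>_def using Dpos by (simp add: algebra_simps)
  also have "\<dots> \<le> 2 - 2 * ((real q - real n + 1) / real q) ^ n"
  proof -
    \<comment> \<open>\<open>1 / Q\<close> is the lower bound for \<open>t\<close>; with it,
      \<open>D * N * t\<close> is at least the ratio estimated in
      \<open>falling_rising_ratio_ge\<close>.\<close>
    define Q where "Q = (\<Prod>i<n. real (p * q + i))"
    have Q: "Q > 0" unfolding Q_def using p nq n by (intro prod_pos) (simp del: of_nat_add of_nat_mult)
    have "1 / Q \<le> t" using r_injective_diag_ge[OF nd e] Q unfolding Q_def[symmetric] t_def[symmetric]
      by (simp add: field_simps)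
    moreover have "0 \<le> N" unfolding N_def by (rule of_nat_0_le_iff)
    ultimately have "real D * N * (1 / Q) \<le> real D * N * t" by (intro mult_left_mono) auto
    moreover have "((real q - real n + 1) / real q) ^ n \<le> real D * N / Q"
      using falling_rising_ratio_ge[OF nq p n] unfolding D_def N_def Q_def by simp
    ultimately show ?thesis by simp
  qed
  finally show ?thesis unfolding M_def D_def by simp
qed

theorem theorem3:
  fixes p q n :: nat and \<rho> :: "complex mat"
  assumes "0 < p" and "0 < q" and "0 < n" and "n \<le> q"
    and "werner_state (p * q) n \<rho>"
  shows "trace_norm (ptrace_q p q n \<rho> - (1 / of_nat (p ^ n)) \<cdot>\<^sub>m 1\<^sub>m (p ^ n))
           \<le> 2 - 2 * ((real q - real n + 1) / real q) ^ n \<and>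
         (\<exists>C::real. \<forall>m r :: nat. 0 < m \<and> m \<le> r \<longrightarrow>
           \<bar>(2 - 2 * ((real r - real m + 1) / real r) ^ m) - 2 * real m * (real m - 1) / real r\<bar>
             \<le> C * real m ^ 4 / (real r) ^ 2)"
  using ptrace_werner_trace_norm_le[OF assms(1,3,4,5)] bound_asymptotics by (rule conjI)

end
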